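(* Let $\mathcal{H}$ be a complex Hilbert space and let $T$ be a bounded linear operator on $\mathcal{H}$. The following conditions are equivalent: (i) $T$ is a quasinormal partial isometry; (ii) $T$ is absolute-$(p,r)$-paranormal for some real numbers $p,r>0$ and $T^n$ is a partial isometry for some positive integer $n$.
   Context: For a bounded linear operator $T$ on a complex Hilbert space $\mathcal{H}$, $|T|=(T^*T)^{1/2}$ and $|T^*|=(TT^* )^{1/2}$; real positive powers of positive operators are defined by functional calculus. For $p,r>0$, $T$ is called absolute-$(p,r)$-paranormal if $\| |T|^p |T^*|^r x \|^r \geq \| |T^*|^r x \|^{p+r}$ for every unit vector $x\in\mathcal{H}$ (equivalently, $\| |T|^p |T^*|^r x \|^r\|x\|^p \geq \| |T^*|^r x \|^{p+r}$ for all $x\in\mathcal{H}$). $T$ is a partial isometry if $T^*T$ is an orthogonal projection, and quasinormal if $T$ commutes with $T^*T$, i.e. $TT^*T=T^*T^2$. *)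

theory Defs
  imports "HOL-Analysis.Analysis" "HOL-Computational_Algebra.Polynomial"
begin

text \<open>
  Complex inner product spaces, on top of the underlying real normed space; the inner product is
  linear in its first argument.
\<close>

class complex_inner_space = real_normed_vector +
  fixes scaleC :: "complex \<Rightarrow> 'a \<Rightarrow> 'a" (infixr "*\<^sub>C" 75)
    and cinner :: "'a \<Rightarrow> 'a \<Rightarrow> complex"
  assumes scaleC_of_real: "complex_of_real r *\<^sub>C x = r *\<^sub>R x"
    and scaleC_add_right: "c *\<^sub>C (x + y) = c *\<^sub>C x + c *\<^sub>C y"
    and scaleC_add_left: "(c + d) *\<^sub>C x = c *\<^sub>C x + d *\<^sub>C x"
    and scaleC_scaleC: "c *\<^sub>C (d *\<^sub>C x) = (c * d) *\<^sub>C x"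
    and cinner_commute: "cinner x y = cnj (cinner y x)"
    and cinner_add_left: "cinner (x + y) z = cinner x z + cinner y z"
    and cinner_scaleC_left: "cinner (c *\<^sub>C x) y = c * cinner x y"
    and cinner_ge_zero: "0 \<le> Re (cinner x x)"
    and cinner_eq_zero_iff: "cinner x x = 0 \<longleftrightarrow> x = 0"
    and norm_eq_sqrt_cinner: "norm x = sqrt (Re (cinner x x))"

class complex_hilbert_space = complex_inner_space + complete_space

instance complex_hilbert_space \<subseteq> banach ..

text \<open>
  Bounded operators are elements of \<open>'a \<Rightarrow>\<^sub>L 'a\<close>, which are bounded and a priori only real-linear;
  complex-linearity is a separate predicate. The notions below are meant for complex-linear
  operators.
\<close>

definition complex_linear :: "('a::complex_inner_space \<Rightarrow>\<^sub>L 'a) \<Rightarrow> bool" where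
  "complex_linear T \<longleftrightarrow> (\<forall>c x. blinfun_apply T (c *\<^sub>C x) = c *\<^sub>C blinfun_apply T x)"

definition adj :: "('a::complex_hilbert_space \<Rightarrow>\<^sub>L 'a) \<Rightarrow> ('a \<Rightarrow>\<^sub>L 'a)" where
  "adj T = (THE S. \<forall>x y. cinner (blinfun_apply T x) y = cinner x (blinfun_apply S y))"

primrec op_pow :: "('a::real_normed_vector \<Rightarrow>\<^sub>L 'a) \<Rightarrow> nat \<Rightarrow> ('a \<Rightarrow>\<^sub>L 'a)" where
  "op_pow T 0 = id_blinfun"
| "op_pow T (Suc n) = T o\<^sub>L op_pow T n"

definition op_poly :: "real poly \<Rightarrow> ('a::real_normed_vector \<Rightarrow>\<^sub>L 'a) \<Rightarrow> ('a \<Rightarrow>\<^sub>L 'a)" where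
  "op_poly q A = (\<Sum>i\<le>degree q. coeff q i *\<^sub>R op_pow A i)"

text \<open>A two-sided inverse of a complex-linear operator is automatically complex-linear.\<close>

definition spectrum :: "('a::complex_inner_space \<Rightarrow>\<^sub>L 'a) \<Rightarrow> complex set" where
  "spectrum A = {z. \<not> (\<exists>B :: 'a \<Rightarrow>\<^sub>L 'a.
     (\<forall>x. blinfun_apply B (blinfun_apply A x - z *\<^sub>C x) = x) \<and>
     (\<forall>x. blinfun_apply A (blinfun_apply B x) - z *\<^sub>C blinfun_apply B x = x))}"

text \<open>
  Continuous functional calculus \<open>f(A)\<close> for self-adjoint \<open>A\<close>, whose spectrum is a compact set of
  reals, and real-valued \<open>f\<close> continuous on it: the operator-norm limit of \<open>q\<^sub>n(A)\<close> for
  every sequence of real polynomials \<open>q\<^sub>n\<close> converging to \<open>f\<close> uniformly on the spectrum.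
  For other arguments the value is meaningless.
\<close>

definition fun_calc :: "(real \<Rightarrow> real) \<Rightarrow> ('a::complex_hilbert_space \<Rightarrow>\<^sub>L 'a) \<Rightarrow> ('a \<Rightarrow>\<^sub>L 'a)" where
  "fun_calc f A = (THE B. \<forall>q :: nat \<Rightarrow> real poly.
     uniform_limit {t. complex_of_real t \<in> spectrum A} (\<lambda>n. poly (q n)) f sequentially
       \<longrightarrow> (\<lambda>n. op_poly (q n) A) \<longlonglongrightarrow> B)"

text \<open>
  Meant for positive \<open>A\<close> and \<open>a > 0\<close>, where \<open>t powr a\<close> is the usual continuous function on
  the spectrum of \<open>A\<close> (in particular \<open>0 powr a = 0\<close>).
\<close>

definition op_powr :: "('a::complex_hilbert_space \<Rightarrow>\<^sub>L 'a) \<Rightarrow> real \<Rightarrow> ('a \<Rightarrow>\<^sub>L 'a)" where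
  "op_powr A a = fun_calc (\<lambda>t. t powr a) A"

definition op_abs :: "('a::complex_hilbert_space \<Rightarrow>\<^sub>L 'a) \<Rightarrow> ('a \<Rightarrow>\<^sub>L 'a)" where
  "op_abs T = op_powr (adj T o\<^sub>L T) (1 / 2)"

definition absolute_paranormal ::
    "real \<Rightarrow> real \<Rightarrow> ('a::complex_hilbert_space \<Rightarrow>\<^sub>L 'a) \<Rightarrow> bool" where
  "absolute_paranormal p r T \<longleftrightarrow> (\<forall>x. norm x = 1 \<longrightarrow>
     norm (blinfun_apply (op_powr (op_abs T) p o\<^sub>L op_powr (op_abs (adj T)) r) x) powr r
       \<ge> norm (blinfun_apply (op_powr (op_abs (adj T)) r) x) powr (p + r))"

definition orthogonal_projection :: "('a::complex_hilbert_space \<Rightarrow>\<^sub>L 'a) \<Rightarrow> bool" where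
  "orthogonal_projection P \<longleftrightarrow> P o\<^sub>L P = P \<and> adj P = P"

definition partial_isometry :: "('a::complex_hilbert_space \<Rightarrow>\<^sub>L 'a) \<Rightarrow> bool" where
  "partial_isometry T \<longleftrightarrow> orthogonal_projection (adj T o\<^sub>L T)"

definition quasinormal :: "('a::complex_hilbert_space \<Rightarrow>\<^sub>L 'a) \<Rightarrow> bool" where
  "quasinormal T \<longleftrightarrow> T o\<^sub>L (adj T o\<^sub>L T) = (adj T o\<^sub>L T) o\<^sub>L T"

end

theory Submission
  imports Defs "HOL-Computational_Algebra.Fundamental_Theorem_Algebra"
begin

text \<open>
  Write \<open>c = \<parallel>T\<parallel>\<close>. The paranormality inequality acts only through one
  consequence, \<open>absolute_paranormal_approx_eigenvector\<close>: if unit vectors \<open>x\<^sub>m\<close> are asymptotically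
  eigenvectors of \<open>TT\<^sup>*\<close> for the largest possible eigenvalue \<open>c\<^sup>2\<close>, then they are asymptotically
  eigenvectors of \<open>T\<^sup>*T\<close> for \<open>c\<^sup>2\<close>. Indeed \<open>|T\<^sup>*|\<^sup>r x\<^sub>m\<close> is then close to \<open>c\<^sup>r x\<^sub>m\<close>, so the inequality
  forces \<open>\<parallel>|T|\<^sup>p x\<^sub>m\<parallel>\<close> up to its maximum \<open>c\<^sup>p\<close>, which is only possible if \<open>\<parallel>T x\<^sub>m\<parallel>\<close> tends to \<open>c\<close>.

  The vectors \<open>T x\<^sub>m\<close> inherit the hypothesis on \<open>x\<^sub>m\<close>, up to the scalar factor \<open>c\<close>. Iterating from
  vectors on which \<open>T\<^sup>*\<close> nearly attains its norm gives \<open>\<parallel>T\<^sup>n\<parallel> = \<parallel>T\<parallel>\<^sup>n\<close>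
  (\<open>absolute_paranormal_normaloid\<close>). So if \<open>T\<^sup>n\<close> is a partial isometry, then \<open>T\<close> is a contraction.
  Moreover, the first lemma, applied to a constant sequence, shows that \<open>T\<close> maps the space \<open>M\<close> of all \<open>x\<close>
  with \<open>T\<^sup>*T x = x\<close> into itself (\<open>isometric_vectors_invariant\<close>).

  Let \<open>P\<close> be the projection \<open>(T\<^sup>n)\<^sup>*T\<^sup>n\<close>. Since \<open>T\<close> is a contraction that preserves \<open>M\<close>, the range of
  \<open>P\<close> is \<open>M\<close>; its kernel is \<open>ker T\<^sup>n\<close>, which \<open>T\<close> preserves as well. Hence \<open>P\<close> commutes with \<open>T\<close>.
  The part \<open>T(1 - P)\<close> is again absolute-\<open>(p,r)\<close>-paranormal
  (\<open>absolute_paranormal_compose_projection\<close>) and its \<open>n\<close>-th power is zero, so it vanishes by the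
  norm identity. Thus \<open>T = TP\<close> and \<open>T\<^sup>*T = T\<^sup>*TP = P\<close>, a projection commuting with \<open>T\<close>.

  For the converse, a quasinormal partial isometry has \<open>|T| = T\<^sup>*T\<close> and \<open>|T\<^sup>*| = TT\<^sup>*\<close>, and
  \<open>T\<^sup>*T\<close> acts as the identity on the range of \<open>T\<close>; so \<open>p = r = 1\<close> and \<open>n = 1\<close> work.

  The powers \<open>|T|\<^sup>p\<close> are limits of polynomials. That these limits exist rests on the bound
  \<open>\<parallel>q(A)\<parallel> \<le> max |q|\<close>, the maximum being over the spectrum of \<open>A\<close> (\<open>norm_op_poly_le\<close>).
\<close>

section \<open>Complex Hilbert spaces as real ones\<close>

text \<open>
  The real part of the inner product is a real inner product with the same norm. For complex-linear
  operators it determines the adjoint, and as a bounded bilinear map it brings in the standard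
  calculus of limits.
\<close>

definition re_cinner :: "'a::complex_inner_space \<Rightarrow> 'a \<Rightarrow> real" where
  "re_cinner x y = Re (cinner x y)"

lemma cinner_scaleC_right: "cinner x (c *\<^sub>C y) = cnj c * cinner x (y::'a::complex_inner_space)"
  by (metis cinner_commute cinner_scaleC_left complex_cnj_mult)

lemma cinner_scaleR_left: "cinner (r *\<^sub>R x) y = of_real r * cinner x (y::'a::complex_inner_space)"
  by (metis cinner_scaleC_left scaleC_of_real)

lemma re_cinner_commute: "re_cinner x y = re_cinner y x"
  by (metis re_cinner_def cinner_commute complex_cnj(1) complex.sel(1) complex.exhaust)

lemma re_cinner_add_left: "re_cinner (x + y) z = re_cinner x z + re_cinner y z"
  by (simp add: re_cinner_def cinner_add_left)

lemma re_cinner_scaleR_left: "re_cinner (r *\<^sub>R x) y = r * re_cinner x y"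
  by (simp add: re_cinner_def cinner_scaleR_left)

lemma re_cinner_self: "re_cinner x x = (norm x)\<^sup>2"
  by (simp add: re_cinner_def norm_eq_sqrt_cinner cinner_ge_zero)

lemma norm_add_sq: "(norm (x + y))\<^sup>2 = (norm x)\<^sup>2 + 2 * re_cinner x y + (norm (y::'a::complex_inner_space))\<^sup>2"
  unfolding re_cinner_self[symmetric]
  by (smt (verit) re_cinner_add_left re_cinner_commute)

text \<open>Cauchy--Schwarz, read off from the square of the triangle inequality.\<close>

lemma re_cinner_abs_le: "\<bar>re_cinner x y\<bar> \<le> norm x * norm y"
proof -
  have le: "re_cinner u v \<le> norm u * norm v" for u v :: 'a
  proof -
    have "(norm (u + v))\<^sup>2 \<le> (norm u + norm v)\<^sup>2"
      by (intro power_mono norm_triangle_ineq norm_ge_zero)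
    then show ?thesis unfolding norm_add_sq by (simp add: power2_sum)
  qed
  have "re_cinner (- x) y = - re_cinner x y"
    using re_cinner_scaleR_left[of "-1" x y] by simp
  then show ?thesis using le[of x y] le[of "- x" y] by auto
qed

interpretation re_cinner: bounded_bilinear "re_cinner :: 'a::complex_inner_space \<Rightarrow> 'a \<Rightarrow> real"
proof
  show "\<exists>K. \<forall>a b::'a. norm (re_cinner a b) \<le> norm a * norm b * K"
    by (rule exI[of _ 1]) (simp add: re_cinner_abs_le)
  show "re_cinner (x + y) z = re_cinner x z + re_cinner y z" for x y z :: 'a by (rule re_cinner_add_left)
  show "re_cinner x (y + z) = re_cinner x y + re_cinner x z" for x y z :: 'a by (metis re_cinner_add_left re_cinner_commute)
  show "re_cinner (r *\<^sub>R x) y = r *\<^sub>R re_cinner x y" for r and x y :: 'a by (simp add: re_cinner_scaleR_left)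
  show "re_cinner x (r *\<^sub>R y) = r *\<^sub>R re_cinner x y" for r and x y :: 'a
    by (metis re_cinner_scaleR_left re_cinner_commute real_scaleR_def)
qed

lemma norm_diff_sq: "(norm (x - y))\<^sup>2 = (norm x)\<^sup>2 - 2 * re_cinner x y + (norm (y::'a::complex_inner_space))\<^sup>2"
  using norm_add_sq[of x "- y"] by (simp add: re_cinner.minus_right)

lemma re_cinner_eq_zeroD: "(\<And>y. re_cinner x y = 0) \<Longrightarrow> x = (0::'a::complex_inner_space)"
  using re_cinner_self[of x] by simp

lemma re_cinner_eqD: "(\<And>y. re_cinner y x = re_cinner y z) \<Longrightarrow> x = (z::'a::complex_inner_space)"
  using re_cinner_self[of "x - z"] by (simp add: re_cinner.diff_right)

text \<open>Multiplying the first argument by \<open>\<i>\<close> recovers the imaginary part.\<close>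

lemma cinner_eq_of_re_cinner:
  "cinner x y = Complex (re_cinner x y) (- re_cinner (\<i> *\<^sub>C x) (y::'a::complex_inner_space))"
  by (simp add: re_cinner_def cinner_scaleC_left complex_eq_iff)

lemma norm_scaleC: "norm (c *\<^sub>C x) = cmod c * norm (x::'a::complex_inner_space)"
proof -
  have "cinner (c *\<^sub>C x) (c *\<^sub>C x) = of_real ((cmod c)\<^sup>2) * cinner x x"
    by (simp add: cinner_scaleC_left cinner_scaleC_right complex_norm_square mult_ac del: of_real_power)
  then have "re_cinner (c *\<^sub>C x) (c *\<^sub>C x) = (cmod c)\<^sup>2 * re_cinner x x"
    by (simp add: re_cinner_def Re_complex_of_real)
  then have "(norm (c *\<^sub>C x))\<^sup>2 = (cmod c * norm x)\<^sup>2"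
    by (simp add: re_cinner_self power_mult_distrib)
  then show ?thesis by simp
qed

section \<open>Orthogonal projection, Riesz representation and adjoints\<close>

text \<open>
  By the parallelogram law a minimising sequence for the distance from \<open>x\<close> to \<open>C\<close> is Cauchy; at its
  limit \<open>y\<close>, minimality makes the first variation vanish, that is, \<open>x - y\<close> is orthogonal to \<open>C\<close>.
\<close>

lemma nearest_point_of_closed_subspace:
  fixes C :: "'a::complex_hilbert_space set"
  assumes cl: "closed C" and sub: "subspace C"
  shows "\<exists>y\<in>C. \<forall>z\<in>C. re_cinner (x - y) z = 0"
proof -
  define d where "d = (INF z\<in>C. (norm (x - z))\<^sup>2)"
  have ne: "C \<noteq> {}" using sub subspace_0 by blast
  have bdd: "bdd_below ((\<lambda>z. (norm (x - z))\<^sup>2) ` C)" by (rule bdd_belowI[of _ 0]) auto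
  have d_le: "d \<le> (norm (x - z))\<^sup>2" if "z \<in> C" for z
    unfolding d_def by (rule cINF_lower[OF bdd that])
  have "\<exists>z\<in>C. (norm (x - z))\<^sup>2 < d + 1 / real (Suc k)" for k
    using cINF_less_iff[OF ne bdd, of "d + 1 / real (Suc k)"] by (simp add: d_def)
  then obtain s where sC: "\<And>k. s k \<in> C" and s: "\<And>k. (norm (x - s k))\<^sup>2 < d + 1 / real (Suc k)"
    by metis
  have bound: "(norm (s j - s k))\<^sup>2 \<le> 2 / real (Suc j) + 2 / real (Suc k)" for j k
  proof -
    \<comment> \<open>the midpoint also lies in \<open>C\<close>, so its distance bounds \<open>d\<close> in the parallelogram law\<close>
    have mid: "(1/2) *\<^sub>R (s j + s k) \<in> C"
      using sub sC by (simp add: subspace_add subspace_scale)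
    have "x - (1/2) *\<^sub>R (s j + s k) = (1/2) *\<^sub>R ((x - s j) + (x - s k))"
      by (simp add: algebra_simps flip: scaleR_add_left)
    then have "(norm (x - (1/2) *\<^sub>R (s j + s k)))\<^sup>2 = (norm ((x - s j) + (x - s k)))\<^sup>2 / 4"
      by (simp add: power_divide)
    then have "4 * d \<le> (norm ((x - s j) + (x - s k)))\<^sup>2"
      using d_le[OF mid] by simp
    moreover have "(norm (s j - s k))\<^sup>2 = (norm ((x - s j) - (x - s k)))\<^sup>2"
      by (simp add: norm_minus_commute)
    ultimately show ?thesis
      using s[of j] s[of k] unfolding norm_add_sq norm_diff_sq[of "x - s j" "x - s k"] by simp
  qed
  have "Cauchy s"
  proof (rule metric_CauchyI)
    fix e :: real assume e: "0 < e"
    obtain M where M: "4 / e\<^sup>2 < real M" using reals_Archimedean2 by blast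
    have "dist (s j) (s k) < e" if jk: "j \<ge> M" "k \<ge> M" for j k
    proof -
      have M0: "real M > 0" using M e by (smt (verit) divide_pos_pos zero_less_power)
      have "2 / real (Suc j) + 2 / real (Suc k) \<le> 2 / real M + 2 / real M"
        using jk M0 by (intro add_mono divide_left_mono) auto
      also have "\<dots> < e\<^sup>2" using M M0 e by (simp add: field_simps)
      finally have "(norm (s j - s k))\<^sup>2 < e\<^sup>2" using bound[of j k] by linarith
      then show ?thesis using e by (simp add: dist_norm power2_less_imp_less)
    qed
    then show "\<exists>M. \<forall>m\<ge>M. \<forall>n\<ge>M. dist (s m) (s n) < e" by blast
  qed
  then obtain y where y: "s \<longlonglongrightarrow> y" using Cauchy_convergent convergent_def by blast
  have yC: "y \<in> C" using cl sC y closed_sequentially by blast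
  have "(\<lambda>k. (norm (x - s k))\<^sup>2) \<longlonglongrightarrow> (norm (x - y))\<^sup>2" by (intro tendsto_intros y)
  moreover have "(\<lambda>k. d + 1 / real (Suc k)) \<longlonglongrightarrow> d + 0"
    by (intro tendsto_intros LIMSEQ_Suc[OF lim_1_over_n])
  ultimately have yd: "(norm (x - y))\<^sup>2 \<le> d"
    using s by (intro LIMSEQ_le[of _ _ _ d]) (auto intro!: exI[of _ 0] less_imp_le)
  have "re_cinner (x - y) z = 0" if z: "z \<in> C" for z
  proof (rule ccontr)
    assume nz: "re_cinner (x - y) z \<noteq> 0"
    then have z0: "norm z > 0" using re_cinner.zero_right by force
    \<comment> \<open>the minimiser of \<open>\<parallel>x - y - t z\<parallel>\<^sup>2\<close> over real \<open>t\<close>\<close>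
    define t where "t = re_cinner (x - y) z / (norm z)\<^sup>2"
    have "y + t *\<^sub>R z \<in> C" using sub yC z by (simp add: subspace_add subspace_scale)
    have "(norm (x - y))\<^sup>2 \<le> (norm ((x - y) - t *\<^sub>R z))\<^sup>2"
      using yd d_le[OF \<open>y + t *\<^sub>R z \<in> C\<close>] unfolding diff_diff_eq by (rule order_trans)
    then have "2 * t * re_cinner (x - y) z \<le> t\<^sup>2 * (norm z)\<^sup>2"
      unfolding norm_diff_sq[of "x - y"] by (simp add: re_cinner.scaleR_right power_mult_distrib)
    moreover have "t\<^sup>2 * (norm z)\<^sup>2 = t * re_cinner (x - y) z"
      using z0 by (simp add: t_def power2_eq_square)
    ultimately have "t * re_cinner (x - y) z \<le> 0" by simp
    moreover have "t * re_cinner (x - y) z = (re_cinner (x - y) z)\<^sup>2 / (norm z)\<^sup>2"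
      by (simp add: t_def power2_eq_square)
    moreover have "(re_cinner (x - y) z)\<^sup>2 / (norm z)\<^sup>2 > 0" using nz z0 by simp
    ultimately show False by linarith
  qed
  with yC show ?thesis by blast
qed

text \<open>The representing vector is normal to the kernel.\<close>

lemma riesz_representation:
  fixes \<phi> :: "'a::complex_hilbert_space \<Rightarrow> real"
  assumes "bounded_linear \<phi>"
  obtains s where "\<And>x. \<phi> x = re_cinner x s"
proof (cases "\<forall>x. \<phi> x = 0")
  case True
  then show ?thesis using that[of 0] by (simp add: re_cinner.zero_right)
next
  case False
  then obtain u where u: "\<phi> u \<noteq> 0" by blast
  interpret \<phi>: bounded_linear \<phi> by fact
  have "closed {x. \<phi> x = 0}"
    by (rule closed_Collect_eq[OF linear_continuous_on[OF assms] continuous_on_const])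
  moreover have "subspace {x. \<phi> x = 0}"
    by (simp add: subspace_def \<phi>.zero \<phi>.add \<phi>.scaleR)
  ultimately have "\<exists>y\<in>{x. \<phi> x = 0}. \<forall>z\<in>{x. \<phi> x = 0}. re_cinner (u - y) z = 0"
    by (rule nearest_point_of_closed_subspace)
  then obtain y where y: "\<phi> y = 0" "\<forall>z. \<phi> z = 0 \<longrightarrow> re_cinner (u - y) z = 0" by auto
  define w where "w = u - y"
  have w: "\<phi> w \<noteq> 0" using u y(1) by (simp add: w_def \<phi>.diff)
  have w0: "norm w \<noteq> 0"
  proof
    assume "norm w = 0"
    then have "w = 0" by simp
    then show False using w \<phi>.zero by simp
  qed
  have "\<phi> x = re_cinner x ((\<phi> w / (norm w)\<^sup>2) *\<^sub>R w)" for x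
  proof -
    have "re_cinner w (x - (\<phi> x / \<phi> w) *\<^sub>R w) = 0"
      unfolding w_def by (rule y(2)[rule_format]) (use w in \<open>simp add: w_def \<phi>.diff \<phi>.scaleR\<close>)
    then have "re_cinner x w = \<phi> x / \<phi> w * (norm w)\<^sup>2"
      by (simp add: re_cinner.diff_right re_cinner.scaleR_right re_cinner_self re_cinner_commute)
    then show ?thesis using w w0 by (simp add: re_cinner.scaleR_right)
  qed
  then show ?thesis by (rule that)
qed

text \<open>
  Riesz representation of \<open>x \<mapsto> Re \<langle>T x, y\<rangle>\<close> gives the adjoint for the real inner product;
  complex-linearity of \<open>T\<close> upgrades this to the complex one.
\<close>

lemma adjoint_exists:
  fixes T :: "'a::complex_hilbert_space \<Rightarrow>\<^sub>L 'a"
  assumes T: "complex_linear T"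
  shows "\<exists>!S. \<forall>x y. cinner (blinfun_apply T x) y = cinner x (blinfun_apply S y)"
proof -
  have "\<exists>s. \<forall>x. re_cinner (blinfun_apply T x) y = re_cinner x s" for y
  proof -
    have "bounded_linear (\<lambda>x. re_cinner (blinfun_apply T x) y)"
      by (intro bounded_linear_compose[OF re_cinner.bounded_linear_left] blinfun.bounded_linear_right)
    from riesz_representation[OF this] show ?thesis by blast
  qed
  then obtain S where S: "\<And>x y. re_cinner (blinfun_apply T x) y = re_cinner x (S y)" by metis
  have lin: "bounded_linear S"
  proof (rule bounded_linear_intro[of _ "norm T"])
    show "S (y + z) = S y + S z" for y z
      by (rule re_cinner_eqD) (simp add: S[symmetric] re_cinner.add_right)
    show "S (r *\<^sub>R y) = r *\<^sub>R S y" for r y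
      by (rule re_cinner_eqD) (simp add: S[symmetric] re_cinner.scaleR_right)
    show "norm (S y) \<le> norm y * norm T" for y
    proof -
      have "(norm (S y))\<^sup>2 = re_cinner (blinfun_apply T (S y)) y" by (simp add: S re_cinner_self)
      also have "\<dots> \<le> norm (blinfun_apply T (S y)) * norm y" using re_cinner_abs_le abs_le_D1 by blast
      also have "\<dots> \<le> norm T * norm (S y) * norm y"
        by (intro mult_right_mono norm_blinfun norm_ge_zero)
      finally have "norm (S y) * norm (S y) \<le> norm (S y) * (norm y * norm T)"
        by (simp add: power2_eq_square mult_ac)
      then show ?thesis by (cases "norm (S y) = 0") auto
    qed
  qed
  have c: "cinner (blinfun_apply T x) y = cinner x (S y)" for x y
  proof -
    have "re_cinner (\<i> *\<^sub>C blinfun_apply T x) y = re_cinner (\<i> *\<^sub>C x) (S y)"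
      using S[of "\<i> *\<^sub>C x" y] T by (simp add: complex_linear_def)
    then show ?thesis by (simp add: cinner_eq_of_re_cinner[of _ y] cinner_eq_of_re_cinner[of _ "S y"] S)
  qed
  show ?thesis
  proof (rule ex1I[of _ "Blinfun S"])
    show "\<forall>x y. cinner (blinfun_apply T x) y = cinner x (blinfun_apply (Blinfun S) y)"
      by (simp add: bounded_linear_Blinfun_apply[OF lin] c)
    show "R = Blinfun S" if "\<forall>x y. cinner (blinfun_apply T x) y = cinner x (blinfun_apply R y)" for R
    proof (rule blinfun_eqI, rule re_cinner_eqD)
      show "re_cinner x (blinfun_apply R y) = re_cinner x (blinfun_apply (Blinfun S) y)" for x y
        using that by (simp add: bounded_linear_Blinfun_apply[OF lin] re_cinner_def flip: c)
    qed
  qed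
qed

lemma cinner_adj:
  assumes "complex_linear T"
  shows "cinner (blinfun_apply T x) y = cinner x (blinfun_apply (adj T) y)"
proof -
  have "\<forall>x y. cinner (blinfun_apply T x) y = cinner x (blinfun_apply (adj T) y)"
    unfolding adj_def by (rule theI'[OF adjoint_exists[OF assms]])
  then show ?thesis by simp
qed

lemma re_cinner_adj: "complex_linear T \<Longrightarrow> re_cinner (blinfun_apply T x) y = re_cinner x (blinfun_apply (adj T) y)"
  by (simp add: re_cinner_def cinner_adj)

lemma re_cinner_adj': "complex_linear T \<Longrightarrow> re_cinner x (blinfun_apply T y) = re_cinner (blinfun_apply (adj T) x) y"
  using re_cinner_adj[of T y x] re_cinner_commute[of x "blinfun_apply T y"]
    re_cinner_commute[of y "blinfun_apply (adj T) x"] by simp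

lemma adj_eqI:
  assumes "complex_linear T" "\<And>x y. re_cinner (blinfun_apply T x) y = re_cinner x (blinfun_apply S y)"
  shows "adj T = S"
  by (rule blinfun_eqI, rule re_cinner_eqD) (simp add: assms flip: re_cinner_adj)

lemma complex_linear_adj [simp]:
  assumes "complex_linear T" shows "complex_linear (adj T)"
  unfolding complex_linear_def
proof (intro allI)
  fix c y
  show "blinfun_apply (adj T) (c *\<^sub>C y) = c *\<^sub>C blinfun_apply (adj T) y"
    by (rule re_cinner_eqD) (simp add: re_cinner_def cinner_scaleC_right flip: cinner_adj[OF assms])
qed

lemma adj_adj [simp]: "complex_linear T \<Longrightarrow> adj (adj T) = T"
  by (rule adj_eqI) (simp_all add: re_cinner_adj')

lemma complex_linear_compose [simp]:
  "complex_linear A \<Longrightarrow> complex_linear B \<Longrightarrow> complex_linear (A o\<^sub>L B)"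
  by (simp add: complex_linear_def)

lemma adj_compose: "complex_linear A \<Longrightarrow> complex_linear B \<Longrightarrow> adj (A o\<^sub>L B) = adj B o\<^sub>L adj A"
  by (rule adj_eqI) (simp_all add: re_cinner_adj)

section \<open>Complex-linear operators\<close>

lemma scaleC_zero_right [simp]: "c *\<^sub>C (0::'a::complex_inner_space) = 0"
  using scaleC_add_right[of c "0::'a" 0] by simp

lemma scaleC_zero_left [simp]: "0 *\<^sub>C (x::'a::complex_inner_space) = 0"
  using scaleC_of_real[of 0 x] by simp

lemma scaleC_minus_left: "(- c) *\<^sub>C (x::'a::complex_inner_space) = - (c *\<^sub>C x)"
  using scaleC_add_left[of "-c" c x] by (simp add: eq_neg_iff_add_eq_0)

lemma scaleC_scaleR: "c *\<^sub>C (r *\<^sub>R (x::'a::complex_inner_space)) = r *\<^sub>R (c *\<^sub>C x)"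
  by (simp add: scaleC_scaleC mult.commute flip: scaleC_of_real)

lemma complex_linear_id [simp]: "complex_linear id_blinfun"
  by (simp add: complex_linear_def)

lemma complex_linear_zero [simp]: "complex_linear 0"
  by (simp add: complex_linear_def)

lemma complex_linear_add [simp]:
  "complex_linear A \<Longrightarrow> complex_linear B \<Longrightarrow> complex_linear (A + B)"
  by (simp add: complex_linear_def blinfun.add_left scaleC_add_right)

lemma complex_linear_scaleR [simp]: "complex_linear A \<Longrightarrow> complex_linear (r *\<^sub>R A)"
  by (simp add: complex_linear_def blinfun.scaleR_left scaleC_scaleR)

lemma complex_linear_op_pow [simp]: "complex_linear A \<Longrightarrow> complex_linear (op_pow A n)"
  by (induction n) auto

section \<open>Polynomials in a self-adjoint operator\<close>

definition selfadj :: "('a::complex_hilbert_space \<Rightarrow>\<^sub>L 'a) \<Rightarrow> bool" where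
  "selfadj A \<longleftrightarrow> complex_linear A \<and> adj A = A"

lemma selfadj_linear: "selfadj A \<Longrightarrow> complex_linear A"
  by (simp add: selfadj_def)

lemma selfadj_re_cinner: "selfadj A \<Longrightarrow> re_cinner (blinfun_apply A x) y = re_cinner x (blinfun_apply A y)"
  using re_cinner_adj[of A x y] by (simp add: selfadj_def)

lemma selfadjI:
  assumes "complex_linear A" "\<And>x y. re_cinner (blinfun_apply A x) y = re_cinner x (blinfun_apply A y)"
  shows "selfadj A"
  using assms adj_eqI[of A A] by (simp add: selfadj_def)

interpretation blinfun_compose: bounded_bilinear blinfun_compose
  by (rule bounded_bilinear_blinfun_compose)

lemma op_poly_altdef:
  assumes "degree q \<le> n"
  shows "op_poly q A = (\<Sum>i\<le>n. coeff q i *\<^sub>R op_pow A i)"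
  unfolding op_poly_def using assms
  by (intro sum.mono_neutral_left) (auto simp: coeff_eq_0)

lemma op_poly_0 [simp]: "op_poly 0 A = 0"
  by (simp add: op_poly_def)

lemma op_poly_pCons: "op_poly (pCons a q) A = a *\<^sub>R id_blinfun + (A o\<^sub>L op_poly q A)"
proof -
  have "op_poly (pCons a q) A = (\<Sum>i\<le>Suc (degree q). coeff (pCons a q) i *\<^sub>R op_pow A i)"
    by (rule op_poly_altdef) (rule degree_pCons_le)
  also have "\<dots> = a *\<^sub>R id_blinfun + (A o\<^sub>L op_poly q A)"
    by (simp only: sum.atMost_Suc_shift)
       (simp add: op_poly_def blinfun_compose.sum_right blinfun_compose.scaleR_right)
  finally show ?thesis .
qed

lemma op_poly_add: "op_poly (p + q) A = op_poly p A + op_poly q A"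
proof -
  let ?n = "max (degree p) (degree q)"
  have "degree (p + q) \<le> ?n" by (rule degree_add_le_max)
  then show ?thesis
    by (simp add: op_poly_altdef[of _ ?n] scaleR_add_left sum.distrib)
qed

lemma op_poly_smult: "op_poly (smult c p) A = c *\<^sub>R op_poly p A"
  by (induction p) (simp_all add: op_poly_pCons blinfun_compose.scaleR_right scaleR_add_right)

lemma op_poly_diff: "op_poly (p - q) A = op_poly p A - op_poly q A"
  using op_poly_add[of p "smult (-1) q" A] op_poly_smult[of "-1" q A] by simp

lemma op_poly_mult: "op_poly (p * q) A = op_poly p A o\<^sub>L op_poly q A"
proof (induction p)
  case (pCons a p)
  show ?case
    by (rule blinfun_eqI)
       (simp add: mult_pCons_left op_poly_add op_poly_smult op_poly_pCons pCons.IH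
        blinfun.add_left blinfun.scaleR_left)
qed (simp add: blinfun_compose.zero_left)

lemma complex_linear_op_poly [simp]: "complex_linear A \<Longrightarrow> complex_linear (op_poly q A)"
  by (induction q) (simp_all add: op_poly_pCons)

lemma op_pow_commute:
  "blinfun_apply (op_pow A n) (blinfun_apply A x) = blinfun_apply A (blinfun_apply (op_pow A n) x)"
  by (induction n) simp_all

lemma selfadj_op_pow: "selfadj A \<Longrightarrow> selfadj (op_pow A n)"
proof (induction n)
  case 0 show ?case by (rule selfadjI) auto
next
  case (Suc n)
  then have s: "selfadj (op_pow A n)" by simp
  show ?case
  proof (rule selfadjI)
    show "complex_linear (op_pow A (Suc n))" using Suc.prems by (simp add: selfadj_linear)
    show "re_cinner (blinfun_apply (op_pow A (Suc n)) x) y = re_cinner x (blinfun_apply (op_pow A (Suc n)) y)" for x y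
      by (simp add: selfadj_re_cinner[OF Suc.prems] selfadj_re_cinner[OF s] op_pow_commute)
  qed
qed

lemma selfadj_zero: "selfadj 0"
  by (rule selfadjI) (auto simp: re_cinner.zero_left re_cinner.zero_right)

lemma selfadj_id: "selfadj id_blinfun"
  by (rule selfadjI) auto

lemma selfadj_add: "selfadj A \<Longrightarrow> selfadj B \<Longrightarrow> selfadj (A + B)"
  by (rule selfadjI)
     (simp_all add: selfadj_linear selfadj_re_cinner blinfun.add_left re_cinner.add_left re_cinner.add_right)

lemma selfadj_scaleR: "selfadj A \<Longrightarrow> selfadj (r *\<^sub>R A)"
  by (rule selfadjI)
     (simp_all add: selfadj_linear selfadj_re_cinner blinfun.scaleR_left re_cinner.scaleR_left re_cinner.scaleR_right)

lemma selfadj_op_poly: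
  assumes "selfadj A" shows "selfadj (op_poly q A)"
proof -
  have "selfadj (\<Sum>i\<in>I. coeff q i *\<^sub>R op_pow A i)" for I
    by (induction I rule: infinite_finite_induct)
       (auto intro: selfadj_zero selfadj_add selfadj_scaleR selfadj_op_pow assms)
  then show ?thesis by (simp add: op_poly_def)
qed

section \<open>Spectra of self-adjoint operators\<close>

definition bounded_away :: "('a::real_normed_vector \<Rightarrow> 'a) \<Rightarrow> bool" where
  "bounded_away f \<longleftrightarrow> (\<exists>e>0. \<forall>x. e * norm x \<le> norm (f x))"

lemma spectrumI_not_bounded_away:
  assumes "\<not> bounded_away (\<lambda>x. blinfun_apply A x - z *\<^sub>C x)"
  shows "z \<in> spectrum A"
proof (rule ccontr)
  assume "z \<notin> spectrum A"
  then obtain B where B: "\<And>x. blinfun_apply B (blinfun_apply A x - z *\<^sub>C x) = x"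
    by (auto simp: spectrum_def)
  have "norm x \<le> (norm B + 1) * norm (blinfun_apply A x - z *\<^sub>C x)" for x
  proof -
    have "norm x \<le> norm B * norm (blinfun_apply A x - z *\<^sub>C x)"
      using norm_blinfun[of B "blinfun_apply A x - z *\<^sub>C x"] by (simp add: B)
    also have "\<dots> \<le> (norm B + 1) * norm (blinfun_apply A x - z *\<^sub>C x)"
      by (intro mult_right_mono) auto
    finally show ?thesis .
  qed
  moreover have "0 < norm B + 1" by (simp add: add_nonneg_pos)
  ultimately have "bounded_away (\<lambda>x. blinfun_apply A x - z *\<^sub>C x)"
    unfolding bounded_away_def
    by (intro exI[of _ "1 / (norm B + 1)"]) (simp add: pos_divide_le_eq mult.commute)
  with assms show False by blast
qed

text \<open>
  The lower bound makes the range of \<open>S\<close> closed. The error of the best approximation to \<open>z\<close> in the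
  range is orthogonal to the range, hence killed by \<open>S\<close> (self-adjointness), hence zero.
\<close>

lemma selfadj_bounded_away_surj:
  fixes S :: "'a::complex_hilbert_space \<Rightarrow>\<^sub>L 'a"
  assumes S: "selfadj S" and e: "e > 0" and low: "\<And>x. e * norm x \<le> norm (blinfun_apply S x)"
  shows "\<exists>y. blinfun_apply S y = z"
proof -
  have "closed (range (blinfun_apply S))"
  proof -
    have "complete (range (blinfun_apply S))"
      by (rule complete_isometric_image[OF e])
         (use low in \<open>auto simp: blinfun.bounded_linear_right complete_UNIV\<close>)
    then show ?thesis by (rule complete_imp_closed)
  qed
  moreover have "subspace (range (blinfun_apply S))"
    by (intro linear_subspace_image bounded_linear.linear[OF blinfun.bounded_linear_right] subspace_UNIV)
  ultimately obtain y where y: "\<And>u. re_cinner (z - blinfun_apply S y) (blinfun_apply S u) = 0"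
    using nearest_point_of_closed_subspace[of "range (blinfun_apply S)" z] by auto
  have "blinfun_apply S (z - blinfun_apply S y) = 0"
    by (rule re_cinner_eq_zeroD) (simp add: selfadj_re_cinner[OF S] y)
  then have "e * norm (z - blinfun_apply S y) \<le> 0" using low by (metis norm_zero)
  then have "z - blinfun_apply S y = 0" using e by (simp add: mult_le_0_iff)
  then show ?thesis by auto
qed

text \<open>
  For self-adjoint operators the real spectrum consists of approximate eigenvalues only; this is the
  converse of \<open>spectrumI_not_bounded_away\<close>.
\<close>

lemma bounded_away_notin_spectrum:
  fixes A :: "'a::complex_hilbert_space \<Rightarrow>\<^sub>L 'a"
  assumes A: "selfadj A" and b: "bounded_away (\<lambda>x. blinfun_apply A x - t *\<^sub>R x)"
  shows "complex_of_real t \<notin> spectrum A"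
proof -
  define S where "S = A - t *\<^sub>R id_blinfun"
  have S_apply: "blinfun_apply S x = blinfun_apply A x - t *\<^sub>R x" for x
    by (simp add: S_def blinfun.diff_left blinfun.scaleR_left)
  have S: "selfadj S"
    using selfadj_add[OF A selfadj_scaleR[OF selfadj_id, of "-t"]] by (simp add: S_def)
  obtain e where e: "e > 0" and low: "\<And>x. e * norm x \<le> norm (blinfun_apply S x)"
    using b by (auto simp: bounded_away_def S_apply)
  have inj: "x = y" if "blinfun_apply S x = blinfun_apply S y" for x y
  proof -
    have "e * norm (x - y) \<le> 0" using low[of "x - y"] that by (simp add: blinfun.diff_right)
    then show ?thesis using e by (simp add: mult_le_0_iff)
  qed
  obtain g where g: "\<And>z. blinfun_apply S (g z) = z"
    using selfadj_bounded_away_surj[OF S e low] by metis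
  have "bounded_linear g"
  proof (rule bounded_linear_intro[of _ "1 / e"])
    show "g (x + y) = g x + g y" for x y by (rule inj) (simp add: g blinfun.add_right)
    show "g (r *\<^sub>R x) = r *\<^sub>R g x" for r x by (rule inj) (simp add: g blinfun.scaleR_right)
    show "norm (g x) \<le> norm x * (1 / e)" for x
      using low[of "g x"] e by (simp add: g pos_le_divide_eq mult.commute)
  qed
  then have "blinfun_apply (Blinfun g) = g" by (rule bounded_linear_Blinfun_apply)
  moreover have "g (blinfun_apply S x) = x" for x by (rule inj) (simp add: g)
  ultimately show ?thesis
    using g unfolding spectrum_def
    by (auto simp: S_apply scaleC_of_real intro!: exI[of _ "Blinfun g"])
qed

text \<open>As \<open>\<langle>A x, x\<rangle>\<close> is real, \<open>\<langle>(A - z) x, x\<rangle>\<close> has imaginary part \<open>- Im z \<parallel>x\<parallel>\<^sup>2\<close>.\<close>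

lemma bounded_away_nonreal:
  fixes A :: "'a::complex_hilbert_space \<Rightarrow>\<^sub>L 'a"
  assumes A: "selfadj A" and z: "Im z \<noteq> 0"
  shows "bounded_away (\<lambda>x. blinfun_apply A x - z *\<^sub>C x)"
proof -
  have "\<bar>Im z\<bar> * norm x \<le> norm (blinfun_apply A x - z *\<^sub>C x)" for x
  proof -
    define w where "w = blinfun_apply A x - z *\<^sub>C x"
    have "cinner (blinfun_apply A x) x = cnj (cinner (blinfun_apply A x) x)"
      using cinner_adj[of A x x] A cinner_commute[of x "blinfun_apply A x"]
      by (simp add: selfadj_def)
    then have 1: "Im (cinner (blinfun_apply A x) x) = 0"
      by (metis complex_cnj_cancel_iff Reals_cnj_iff complex_is_Real_iff)
    have 2: "cinner x x = of_real ((norm x)\<^sup>2)"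
      using cinner_commute[of x x] re_cinner_self[of x]
      by (metis Reals_cnj_iff complex_is_Real_iff complex_eq_iff re_cinner_def Im_complex_of_real Re_complex_of_real)
    have w: "blinfun_apply A x = w + z *\<^sub>C x" by (simp add: w_def)
    have "Im (cinner w x) = - Im z * (norm x)\<^sup>2"
      using 1 unfolding w by (simp add: cinner_add_left cinner_scaleC_left 2)
    moreover have "Im (cinner w x) = - re_cinner (\<i> *\<^sub>C w) x"
      by (simp add: re_cinner_def cinner_scaleC_left)
    ultimately have "\<bar>Im z\<bar> * (norm x)\<^sup>2 = \<bar>re_cinner (\<i> *\<^sub>C w) x\<bar>"
      by (simp add: abs_mult)
    also have "\<dots> \<le> norm w * norm x" using re_cinner_abs_le[of "\<i> *\<^sub>C w" x] by (simp add: norm_scaleC)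
    finally have "norm x * (\<bar>Im z\<bar> * norm x) \<le> norm x * norm w"
      by (simp add: power2_eq_square mult_ac)
    then show ?thesis unfolding w_def by (cases "norm x = 0") (auto simp: mult_le_cancel_left)
  qed
  then show ?thesis using z unfolding bounded_away_def by (intro exI[of _ "\<bar>Im z\<bar>"]) simp
qed

text \<open>
  Polynomials in \<open>A\<close> with complex coefficients, needed in order to split real ones into linear
  factors. They are maps on vectors because bounded operators carry only a real vector space
  structure.
\<close>

definition cpoly :: "complex poly \<Rightarrow> ('a::complex_inner_space \<Rightarrow>\<^sub>L 'a) \<Rightarrow> 'a \<Rightarrow> 'a" where
  "cpoly q A x = (\<Sum>i\<le>degree q. coeff q i *\<^sub>C blinfun_apply (op_pow A i) x)"

lemma cpoly_altdef:
  assumes "degree q \<le> n"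
  shows "cpoly q A x = (\<Sum>i\<le>n. coeff q i *\<^sub>C blinfun_apply (op_pow A i) x)"
  unfolding cpoly_def using assms
  by (intro sum.mono_neutral_left) (auto simp: coeff_eq_0)

lemma cpoly_pCons:
  assumes A: "complex_linear A"
  shows "cpoly (pCons a q) A x = a *\<^sub>C x + blinfun_apply A (cpoly q A x)"
proof -
  have "cpoly (pCons a q) A x = (\<Sum>i\<le>Suc (degree q). coeff (pCons a q) i *\<^sub>C blinfun_apply (op_pow A i) x)"
    by (rule cpoly_altdef) (rule degree_pCons_le)
  also have "\<dots> = a *\<^sub>C x + blinfun_apply A (cpoly q A x)"
    using A by (simp only: sum.atMost_Suc_shift)
       (simp add: cpoly_def blinfun.sum_right complex_linear_def)
  finally show ?thesis .
qed

lemma cpoly_0 [simp]: "cpoly 0 A x = 0"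
  by (simp add: cpoly_def)

lemma cpoly_add: "cpoly (p + q) A x = cpoly p A x + cpoly q A x"
proof -
  let ?n = "max (degree p) (degree q)"
  have "degree (p + q) \<le> ?n" by (rule degree_add_le_max)
  then show ?thesis
    by (simp add: cpoly_altdef[of _ ?n] scaleC_add_left sum.distrib)
qed

lemma cpoly_smult:
  assumes A: "complex_linear A"
  shows "cpoly (smult c p) A x = c *\<^sub>C cpoly p A x"
  using A by (induction p)
    (simp_all add: cpoly_pCons scaleC_add_right complex_linear_def scaleC_scaleC)

lemma cpoly_of_real:
  assumes A: "complex_linear A"
  shows "cpoly (map_poly complex_of_real q) A x = blinfun_apply (op_poly q A) x"
  by (induction q)
     (simp_all add: map_poly_pCons cpoly_pCons[OF A] op_poly_pCons blinfun.add_left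
       blinfun.scaleR_left scaleC_of_real)

lemma poly_map_poly_of_real:
  "poly (map_poly complex_of_real q) (complex_of_real t) = complex_of_real (poly q t)"
  by (induction q) (simp_all add: map_poly_pCons)

text \<open>
  Half of the spectral mapping theorem: splitting off linear factors one root at a time, each factor
  is bounded away from zero and so is their product.
\<close>

lemma bounded_away_cpoly:
  fixes A :: "'a::complex_inner_space \<Rightarrow>\<^sub>L 'a"
  assumes A: "complex_linear A" and q: "q \<noteq> 0"
    and roots: "\<And>z. poly q z = 0 \<Longrightarrow> bounded_away (\<lambda>x. blinfun_apply A x - z *\<^sub>C x)"
  shows "bounded_away (cpoly q A)"
  using q roots
proof (induction "degree q" arbitrary: q)
  case 0
  then obtain a where a: "q = [:a:]" by (metis degree_eq_zeroE)
  with 0 have "a \<noteq> 0" by simp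
  then show ?case
    unfolding bounded_away_def a
    by (intro exI[of _ "cmod a"]) (simp add: cpoly_pCons[OF A] norm_scaleC)
next
  case (Suc n)
  then have "\<not> constant (poly q)" by (simp add: constant_degree)
  then obtain z where z: "poly q z = 0" using fundamental_theorem_of_algebra by blast
  then obtain p where p: "q = [:- z, 1:] * p" by (metis poly_eq_0_iff_dvd dvdE)
  have p0: "p \<noteq> 0" using Suc.prems p by auto
  have "degree q = Suc (degree p)" using p p0 by (simp add: degree_mult_eq del: mult_pCons_left)
  then have "bounded_away (cpoly p A)"
    using Suc.hyps(1)[of p] Suc.hyps(2) p0 Suc.prems(2) p by simp
  then obtain d where d: "d > 0" "\<And>x. d * norm x \<le> norm (cpoly p A x)"
    by (auto simp: bounded_away_def)
  obtain e where e: "e > 0" "\<And>x. e * norm x \<le> norm (blinfun_apply A x - z *\<^sub>C x)"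
    using Suc.prems(2)[OF z] by (auto simp: bounded_away_def)
  have "q = smult (- z) p + pCons 0 p" by (simp add: p)
  then have "cpoly q A x = blinfun_apply A (cpoly p A x) - z *\<^sub>C cpoly p A x" for x
    by (simp only: cpoly_add cpoly_pCons[OF A] cpoly_smult[OF A] scaleC_minus_left) simp
  moreover have "e * d * norm x \<le> norm (blinfun_apply A (cpoly p A x) - z *\<^sub>C cpoly p A x)" for x
    using e(2)[of "cpoly p A x"] mult_left_mono[OF d(2)[of x], of e] e(1) by linarith
  ultimately show ?case
    using e(1) d(1) unfolding bounded_away_def by (intro exI[of _ "e * d"]) simp
qed

text \<open>
  With \<open>c = \<parallel>C\<parallel>\<close> one has \<open>\<parallel>(C\<^sup>2 - c\<^sup>2) x\<parallel>\<^sup>2 \<le> c\<^sup>2 (c\<^sup>2 \<parallel>x\<parallel>\<^sup>2 - \<parallel>C x\<parallel>\<^sup>2)\<close>; a lower bound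
  \<open>e \<parallel>x\<parallel>\<close> for the left-hand side would therefore bound \<open>\<parallel>C\<parallel>\<^sup>2\<close> by \<open>c\<^sup>2 - (e / c)\<^sup>2\<close>.
\<close>

lemma selfadj_norm_attained_approx:
  fixes C :: "'a::complex_hilbert_space \<Rightarrow>\<^sub>L 'a"
  assumes C: "selfadj C" and pos: "norm C > 0"
  shows "\<not> bounded_away (\<lambda>x. blinfun_apply C (blinfun_apply C x) - (norm C)\<^sup>2 *\<^sub>R x)"
proof
  define c where "c = norm C"
  assume "bounded_away (\<lambda>x. blinfun_apply C (blinfun_apply C x) - (norm C)\<^sup>2 *\<^sub>R x)"
  then obtain e where e: "e > 0"
    and low: "\<And>x. e * norm x \<le> norm (blinfun_apply C (blinfun_apply C x) - c\<^sup>2 *\<^sub>R x)"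
    by (auto simp: bounded_away_def c_def)
  have c: "c > 0" using pos by (simp add: c_def)
  \<comment> \<open>the maximum guards against the trivial case in which the bound is negative\<close>
  define k where "k = max 0 (c\<^sup>2 - (e / c)\<^sup>2)"
  have "norm (blinfun_apply C x) \<le> sqrt k * norm x" for x
  proof -
    let ?y = "blinfun_apply C x"
    have "norm (blinfun_apply C ?y) \<le> c * norm ?y" unfolding c_def by (rule norm_blinfun)
    then have Cy: "(norm (blinfun_apply C ?y))\<^sup>2 \<le> c\<^sup>2 * (norm ?y)\<^sup>2"
      by (metis norm_ge_zero power_mono power_mult_distrib)
    have "e\<^sup>2 * (norm x)\<^sup>2 \<le> (norm (blinfun_apply C ?y - c\<^sup>2 *\<^sub>R x))\<^sup>2"
      using power_mono[OF low[of x], of 2] e by (simp add: power_mult_distrib)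
    also have "\<dots> = (norm (blinfun_apply C ?y))\<^sup>2 - 2 * c\<^sup>2 * (norm ?y)\<^sup>2 + c\<^sup>2 * c\<^sup>2 * (norm x)\<^sup>2"
      by (simp add: norm_diff_sq re_cinner.scaleR_right selfadj_re_cinner[OF C] re_cinner_self power_mult_distrib
        power2_eq_square[of "c\<^sup>2"])
    also have "\<dots> \<le> c\<^sup>2 * (c\<^sup>2 * (norm x)\<^sup>2 - (norm ?y)\<^sup>2)"
      using Cy by (simp add: algebra_simps)
    finally have "(e / c)\<^sup>2 * (norm x)\<^sup>2 \<le> c\<^sup>2 * (norm x)\<^sup>2 - (norm ?y)\<^sup>2"
      using c by (simp add: power_divide pos_divide_le_eq mult.commute)
    then have "(norm ?y)\<^sup>2 \<le> (c\<^sup>2 - (e / c)\<^sup>2) * (norm x)\<^sup>2" by (simp add: algebra_simps)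
    also have "\<dots> \<le> k * (norm x)\<^sup>2" unfolding k_def by (intro mult_right_mono) auto
    finally have "sqrt ((norm ?y)\<^sup>2) \<le> sqrt (k * (norm x)\<^sup>2)" by (rule real_sqrt_le_mono)
    then show ?thesis by (simp add: real_sqrt_mult)
  qed
  then have "norm C \<le> sqrt k" by (intro norm_blinfun_bound) (auto simp: k_def)
  then have "c\<^sup>2 \<le> k" using c by (simp add: c_def real_le_rsqrt sqrt_ge_absD)
  moreover have "(e / c)\<^sup>2 > 0" "c\<^sup>2 > 0" using e c by auto
  ultimately show False unfolding k_def by linarith
qed

text \<open>
  The number \<open>c = \<parallel>q(A)\<parallel>\<close> makes \<open>q(A)\<^sup>2 - c\<^sup>2\<close> fail to be bounded away from zero. So some root \<open>z\<close> of
  \<open>q\<^sup>2 - c\<^sup>2\<close> is an approximate eigenvalue of \<open>A\<close>; it is real, it lies in the spectrum, and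
  \<open>|q(z)| = c\<close>.
\<close>

lemma norm_op_poly_le:
  fixes A :: "'a::complex_hilbert_space \<Rightarrow>\<^sub>L 'a"
  assumes A: "selfadj A" and M: "M \<ge> 0"
    and bound: "\<And>t. complex_of_real t \<in> spectrum A \<Longrightarrow> \<bar>poly q t\<bar> \<le> M"
  shows "norm (op_poly q A) \<le> M"
proof (rule ccontr)
  define C where "C = op_poly q A"
  assume "\<not> norm (op_poly q A) \<le> M"
  then have c: "norm C > M" by (simp add: C_def)
  define g where "g = q * q - [:(norm C)\<^sup>2:]"
  have linA: "complex_linear A" using A by (rule selfadj_linear)
  have C: "selfadj C" unfolding C_def by (rule selfadj_op_poly[OF A])
  have "cpoly (map_poly complex_of_real g) A x
      = blinfun_apply C (blinfun_apply C x) - (norm C)\<^sup>2 *\<^sub>R x" for x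
    by (simp add: cpoly_of_real[OF linA] g_def op_poly_diff op_poly_mult op_poly_pCons
        blinfun.diff_left blinfun.scaleR_left blinfun_compose.zero_right C_def)
  then have nb: "\<not> bounded_away (cpoly (map_poly complex_of_real g) A)"
    using selfadj_norm_attained_approx[OF C] c M
    unfolding bounded_away_def by (metis dual_order.strict_trans2)
  have bnd: "bounded_away (\<lambda>x. blinfun_apply A x - z *\<^sub>C x)"
    if z: "poly (map_poly complex_of_real g) z = 0" for z
  proof (cases "Im z = 0")
    case True
    then obtain t where t: "z = complex_of_real t" by (metis complex_is_Real_iff Reals_cases)
    have "complex_of_real (poly g t) = 0" using z by (simp add: t poly_map_poly_of_real)
    then have "poly g t = 0" by simp
    then have "(poly q t)\<^sup>2 = (norm C)\<^sup>2" by (simp add: g_def power2_eq_square)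
    then have "\<bar>poly q t\<bar> = norm C" by (metis abs_norm_cancel power2_eq_iff abs_minus_cancel)
    then show ?thesis using bound[of t] c spectrumI_not_bounded_away[of A z] t by force
  next
    case False
    then show ?thesis by (rule bounded_away_nonreal[OF A])
  qed
  show False
  proof (cases "g = 0")
    case True
    \<comment> \<open>if \<open>q\<^sup>2 - c\<^sup>2\<close> vanishes identically, no number at all would be an approximate eigenvalue of \<open>A\<close>;
      but \<open>\<parallel>A\<parallel>\<close> or \<open>- \<parallel>A\<parallel>\<close> is one, unless the space is trivial\<close>
    have all: "bounded_away (\<lambda>x. blinfun_apply A x - z *\<^sub>C x)" for z
      by (rule bnd) (simp add: True)
    show False
    proof (cases "A = 0")
      case True
      then have "bounded_away (\<lambda>x::'a. 0)" using all[of 0] by simp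
      then obtain e where e: "e > 0" "\<And>x::'a. e * norm x \<le> 0" by (auto simp: bounded_away_def)
      then have "x = 0" for x :: 'a using e(2)[of x] by (simp add: mult_le_0_iff)
      then have "C = 0" by (intro blinfun_eqI) metis
      then show False using c M by simp
    next
      case False
      define h where "h = [:- (norm A)\<^sup>2, 0, 1 :: real:]"
      have "cpoly (map_poly complex_of_real h) A x
          = blinfun_apply A (blinfun_apply A x) - (norm A)\<^sup>2 *\<^sub>R x" for x
        by (simp add: cpoly_of_real[OF linA] h_def op_poly_pCons
            blinfun.add_left blinfun.diff_left blinfun.scaleR_left)
      moreover have "bounded_away (cpoly (map_poly complex_of_real h) A)"
        by (rule bounded_away_cpoly[OF linA _ all]) (simp add: h_def map_poly_eq_0_iff)
      ultimately have "bounded_away (\<lambda>x. blinfun_apply A (blinfun_apply A x) - (norm A)\<^sup>2 *\<^sub>R x)"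
        by (simp add: bounded_away_def)
      then show False using selfadj_norm_attained_approx[OF A] False by simp
    qed
  next
    case False
    then show False using bounded_away_cpoly[OF linA _ bnd] nb by (simp add: map_poly_eq_0_iff)
  qed
qed

section \<open>Functional calculus of positive operators\<close>

definition positive_op :: "('a::complex_hilbert_space \<Rightarrow>\<^sub>L 'a) \<Rightarrow> bool" where
  "positive_op A \<longleftrightarrow> selfadj A \<and> (\<forall>x. 0 \<le> re_cinner (blinfun_apply A x) x)"

lemma positive_op_selfadj: "positive_op A \<Longrightarrow> selfadj A"
  by (simp add: positive_op_def)

lemma spectrum_positive_op:
  assumes A: "positive_op A" and t: "complex_of_real t \<in> spectrum A"
  shows "0 \<le> t" "t \<le> norm A"
proof -
  have nb: "\<not> bounded_away (\<lambda>x. blinfun_apply A x - t *\<^sub>R x)"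
    using bounded_away_notin_spectrum[OF positive_op_selfadj[OF A]] t by blast
  show "0 \<le> t"
  proof (rule ccontr)
    assume neg: "\<not> 0 \<le> t"
    have "- t * norm x \<le> norm (blinfun_apply A x - t *\<^sub>R x)" for x
    proof -
      have "- t * (norm x)\<^sup>2 \<le> re_cinner (blinfun_apply A x - t *\<^sub>R x) x"
        using A by (simp add: positive_op_def re_cinner.diff_left re_cinner.scaleR_left re_cinner_self)
      also have "\<dots> \<le> norm (blinfun_apply A x - t *\<^sub>R x) * norm x"
        using re_cinner_abs_le abs_le_D1 by blast
      finally have "norm x * (- t * norm x) \<le> norm x * norm (blinfun_apply A x - t *\<^sub>R x)"
        by (simp add: power2_eq_square mult_ac)
      then show ?thesis
        by (cases "norm x = 0") (simp, metis mult_le_cancel_left_pos norm_ge_zero order_le_less)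
    qed
    then show False using nb neg unfolding bounded_away_def by (smt (verit))
  qed
  show "t \<le> norm A"
  proof (rule ccontr)
    assume big: "\<not> t \<le> norm A"
    have "(t - norm A) * norm x \<le> norm (blinfun_apply A x - t *\<^sub>R x)" for x
    proof -
      have "norm (t *\<^sub>R x) - norm (blinfun_apply A x) \<le> norm (t *\<^sub>R x - blinfun_apply A x)"
        by (rule norm_triangle_ineq2)
      moreover have "0 \<le> t" using big norm_ge_zero[of A] by linarith
      then have "norm (t *\<^sub>R x) = t * norm x" by simp
      ultimately show ?thesis using norm_blinfun[of A x]
        unfolding left_diff_distrib norm_minus_commute[of "t *\<^sub>R x"] by linarith
    qed
    then show False using nb big unfolding bounded_away_def by (smt (verit))
  qed
qed

lemma polynomial_approximation:
  fixes f :: "real \<Rightarrow> real"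
  assumes "continuous_on {0..R} f"
  shows "\<exists>q :: nat \<Rightarrow> real poly. uniform_limit {0..R} (\<lambda>n. poly (q n)) f sequentially"
proof -
  have "\<exists>q. \<forall>t\<in>{0..R}. \<bar>f t - poly q t\<bar> < 1 / real (Suc n)" for n
  proof -
    obtain g where "real_polynomial_function g" and g: "\<And>t. t \<in> {0..R} \<Longrightarrow> \<bar>f t - g t\<bar> < 1 / real (Suc n)"
      using Stone_Weierstrass_real_polynomial_function[OF compact_Icc assms, of "1 / real (Suc n)"] by auto
    then obtain a m where am: "g = (\<lambda>x. \<Sum>i\<le>m. a i * x ^ i)"
      by (auto simp: real_polynomial_function_iff_sum)
    have "poly (\<Sum>i\<le>(m::nat). monom (a i) i) = g" by (rule ext) (simp add: am poly_sum poly_monom)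
    with g show ?thesis by metis
  qed
  then obtain q where q: "\<And>n t. t \<in> {0..R} \<Longrightarrow> \<bar>f t - poly (q n) t\<bar> < 1 / real (Suc n)" by metis
  have "uniform_limit {0..R} (\<lambda>n. poly (q n)) f sequentially"
  proof (rule uniform_limitI)
    fix e :: real assume "0 < e"
    then have "\<forall>\<^sub>F n in sequentially. 1 / real (Suc n) < e"
      using order_tendstoD(2)[OF LIMSEQ_Suc[OF lim_1_over_n]] by blast
    then show "\<forall>\<^sub>F n in sequentially. \<forall>t\<in>{0..R}. dist (poly (q n) t) (f t) < e"
      by eventually_elim (metis q dist_real_def abs_minus_commute order_less_trans)
  qed
  then show ?thesis by blast
qed

text \<open>
  Any two polynomial sequences with the same uniform limit on the spectrum are interchangeable in
  the operator norm. Taken with \<open>p = q\<close> this says that the operator sequence is Cauchy.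
\<close>

lemma op_poly_dist_eventually:
  fixes A :: "'a::complex_hilbert_space \<Rightarrow>\<^sub>L 'a"
  assumes A: "selfadj A" and e: "e > 0"
    and p: "uniform_limit {t. complex_of_real t \<in> spectrum A} (\<lambda>n. poly (p n)) f sequentially"
    and q: "uniform_limit {t. complex_of_real t \<in> spectrum A} (\<lambda>n. poly (q n)) f sequentially"
  shows "\<exists>N::nat. \<forall>m\<ge>N. \<forall>n\<ge>N. dist (op_poly (p m) A) (op_poly (q n) A) < e"
proof -
  let ?S = "{t. complex_of_real t \<in> spectrum A}"
  have "\<forall>\<^sub>F n in sequentially. (\<forall>t\<in>?S. dist (poly (p n) t) (f t) < e / 4) \<and> (\<forall>t\<in>?S. dist (poly (q n) t) (f t) < e / 4)"
    using uniform_limitD[OF p, of "e/4"] uniform_limitD[OF q, of "e/4"] e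
    by (auto intro: eventually_conj)
  then obtain N where N: "\<And>n t. n \<ge> N \<Longrightarrow> t \<in> ?S \<Longrightarrow> dist (poly (p n) t) (f t) < e / 4"
    "\<And>n t. n \<ge> N \<Longrightarrow> t \<in> ?S \<Longrightarrow> dist (poly (q n) t) (f t) < e / 4"
    unfolding eventually_sequentially by blast
  have "dist (op_poly (p m) A) (op_poly (q n) A) < e" if "m \<ge> N" "n \<ge> N" for m n
  proof -
    have "norm (op_poly (p m - q n) A) \<le> e / 2"
    proof (rule norm_op_poly_le[OF A])
      fix t assume "complex_of_real t \<in> spectrum A"
      then show "\<bar>poly (p m - q n) t\<bar> \<le> e / 2"
        using N(1)[OF that(1), of t] N(2)[OF that(2), of t]
        unfolding dist_real_def poly_diff mem_Collect_eq by linarith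
    qed (use e in simp)
    then show ?thesis using e by (simp add: op_poly_diff dist_norm)
  qed
  then show ?thesis by blast
qed

text \<open>
  An interval \<open>{0..R}\<close> with \<open>R \<ge> \<parallel>A\<parallel>\<close> contains the spectrum. Such intervals replace the spectrum from
  here on; the freedom in \<open>R\<close> allows the same polynomials to serve two operators at once.
\<close>

lemma fun_calc_tendsto:
  fixes A :: "'a::complex_hilbert_space \<Rightarrow>\<^sub>L 'a"
  assumes A: "positive_op A" and R: "norm A \<le> R"
    and q: "uniform_limit {0..R} (\<lambda>n. poly (q n)) f sequentially"
  shows "(\<lambda>n. op_poly (q n) A) \<longlonglongrightarrow> fun_calc f A"
proof -
  let ?S = "{t. complex_of_real t \<in> spectrum A}"
  have sub: "?S \<subseteq> {0..R}" using spectrum_positive_op[OF A] R by force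
  have sa: "selfadj A" using A by (rule positive_op_selfadj)
  have qS: "uniform_limit ?S (\<lambda>n. poly (q n)) f sequentially"
    by (rule uniform_limit_on_subset[OF q sub])
  have "Cauchy (\<lambda>n. op_poly (q n) A)"
    by (rule metric_CauchyI) (rule op_poly_dist_eventually[OF sa _ qS qS])
  then obtain B where B: "(\<lambda>n. op_poly (q n) A) \<longlonglongrightarrow> B"
    using Cauchy_convergent convergent_def by blast
  have lim: "(\<lambda>n. op_poly (p n) A) \<longlonglongrightarrow> B" if p: "uniform_limit ?S (\<lambda>n. poly (p n)) f sequentially" for p
  proof -
    have "(\<lambda>n. op_poly (p n) A - op_poly (q n) A) \<longlonglongrightarrow> 0"
      unfolding LIMSEQ_def
    proof (intro allI impI)
      fix e :: real assume "e > 0"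
      from op_poly_dist_eventually[OF sa this p qS]
      show "\<exists>N. \<forall>n\<ge>N. dist (op_poly (p n) A - op_poly (q n) A) 0 < e"
        by (auto simp: dist_norm)
    qed
    from tendsto_add[OF this B] show ?thesis by simp
  qed
  have "fun_calc f A = B"
    unfolding fun_calc_def
  proof (rule the_equality)
    show "\<forall>p. uniform_limit ?S (\<lambda>n. poly (p n)) f sequentially \<longrightarrow> (\<lambda>n. op_poly (p n) A) \<longlonglongrightarrow> B"
      using lim by blast
    show "C = B" if "\<forall>p. uniform_limit ?S (\<lambda>n. poly (p n)) f sequentially \<longrightarrow> (\<lambda>n. op_poly (p n) A) \<longlonglongrightarrow> C" for C
      using that qS B LIMSEQ_unique by blast
  qed
  with B show ?thesis by simp
qed

lemma fun_calc_eqI: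
  assumes "positive_op A" "uniform_limit {0..norm A} (\<lambda>n. poly (q n)) f sequentially"
    and "(\<lambda>n. op_poly (q n) A) \<longlonglongrightarrow> B"
  shows "fun_calc f A = B"
  using fun_calc_tendsto[OF assms(1) order_refl assms(2)] assms(3) LIMSEQ_unique by blast

lemma fun_calc_poly: "positive_op A \<Longrightarrow> fun_calc (poly q) A = op_poly q A"
  by (rule fun_calc_eqI[where q = "\<lambda>_. q"]) (auto intro: uniform_limit_const)

lemma fun_calc_cong:
  assumes A: "positive_op A" and f: "continuous_on {0..norm A} f"
    and eq: "\<And>t. 0 \<le> t \<Longrightarrow> t \<le> norm A \<Longrightarrow> f t = g t"
  shows "fun_calc f A = fun_calc g A"
proof -
  obtain q where q: "uniform_limit {0..norm A} (\<lambda>n. poly (q n)) f sequentially"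
    using polynomial_approximation[OF f] by blast
  then have "uniform_limit {0..norm A} (\<lambda>n. poly (q n)) g sequentially"
    using eq by (simp add: uniform_limit_sequentially_iff)
  from fun_calc_tendsto[OF A order_refl this] show ?thesis
    by (rule fun_calc_eqI[OF A q])
qed

lemma fun_calc_diff:
  assumes A: "positive_op A" and f: "continuous_on {0..norm A} f" and g: "continuous_on {0..norm A} g"
  shows "fun_calc (\<lambda>t. f t - g t) A = fun_calc f A - fun_calc g A"
proof -
  obtain p q where p: "uniform_limit {0..norm A} (\<lambda>n. poly (p n)) f sequentially"
    and q: "uniform_limit {0..norm A} (\<lambda>n. poly (q n)) g sequentially"
    using polynomial_approximation[OF f] polynomial_approximation[OF g] by blast
  show ?thesis
  proof (rule fun_calc_eqI[OF A, where q = "\<lambda>n. p n - q n"])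
    show "uniform_limit {0..norm A} (\<lambda>n. poly (p n - q n)) (\<lambda>t. f t - g t) sequentially"
      using uniform_limit_minus[OF p q] by (simp add: uniform_limit_sequentially_iff)
    show "(\<lambda>n. op_poly (p n - q n) A) \<longlonglongrightarrow> fun_calc f A - fun_calc g A"
      unfolding op_poly_diff
      by (intro tendsto_diff fun_calc_tendsto[OF A order_refl] p q)
  qed
qed

lemma fun_calc_mult:
  assumes A: "positive_op A" and f: "continuous_on {0..norm A} f" and g: "continuous_on {0..norm A} g"
  shows "fun_calc (\<lambda>t. f t * g t) A = fun_calc f A o\<^sub>L fun_calc g A"
proof -
  obtain p q where p: "uniform_limit {0..norm A} (\<lambda>n. poly (p n)) f sequentially"
    and q: "uniform_limit {0..norm A} (\<lambda>n. poly (q n)) g sequentially"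
    using polynomial_approximation[OF f] polynomial_approximation[OF g] by blast
  have bdd: "bounded (f ` {0..norm A})" "bounded (g ` {0..norm A})"
    using f g by (auto intro!: compact_imp_bounded compact_continuous_image)
  show ?thesis
  proof (rule fun_calc_eqI[OF A, where q = "\<lambda>n. p n * q n"])
    show "uniform_limit {0..norm A} (\<lambda>n. poly (p n * q n)) (\<lambda>t. f t * g t) sequentially"
      using uniform_lim_mult[OF p q bdd] by (simp add: uniform_limit_sequentially_iff)
    show "(\<lambda>n. op_poly (p n * q n) A) \<longlonglongrightarrow> (fun_calc f A o\<^sub>L fun_calc g A)"
      unfolding op_poly_mult
      by (intro blinfun_compose.tendsto fun_calc_tendsto[OF A order_refl] p q)
  qed
qed

lemma tendsto_blinfun_apply: "B \<longlonglongrightarrow> C \<Longrightarrow> (\<lambda>n. blinfun_apply (B n) x) \<longlonglongrightarrow> blinfun_apply C x"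
  by (intro blinfun.tendsto tendsto_const)

lemma selfadj_limit:
  assumes B: "B \<longlonglongrightarrow> C" and sa: "\<And>n::nat. selfadj (B n)"
  shows "selfadj C"
proof (rule selfadjI)
  show "re_cinner (blinfun_apply C x) y = re_cinner x (blinfun_apply C y)" for x y
  proof (rule LIMSEQ_unique)
    show "(\<lambda>n. re_cinner (blinfun_apply (B n) x) y) \<longlonglongrightarrow> re_cinner (blinfun_apply C x) y"
      by (intro re_cinner.tendsto tendsto_blinfun_apply B tendsto_const)
    have "(\<lambda>n. re_cinner x (blinfun_apply (B n) y)) \<longlonglongrightarrow> re_cinner x (blinfun_apply C y)"
      by (intro re_cinner.tendsto tendsto_blinfun_apply B tendsto_const)
    then show "(\<lambda>n. re_cinner (blinfun_apply (B n) x) y) \<longlonglongrightarrow> re_cinner x (blinfun_apply C y)"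
      by (simp add: selfadj_re_cinner[OF sa])
  qed
  have "bounded_linear (\<lambda>x::'a. c *\<^sub>C x)" for c
    by (rule bounded_linear_intro[of _ "cmod c"])
       (auto simp: scaleC_add_right scaleC_scaleR norm_scaleC)
  then have "(\<lambda>n. c *\<^sub>C blinfun_apply (B n) x) \<longlonglongrightarrow> c *\<^sub>C blinfun_apply C x" for c x
    by (rule bounded_linear.tendsto) (rule tendsto_blinfun_apply[OF B])
  moreover have "(\<lambda>n. blinfun_apply (B n) (c *\<^sub>C x)) \<longlonglongrightarrow> blinfun_apply C (c *\<^sub>C x)" for c x
    by (rule tendsto_blinfun_apply[OF B])
  moreover have "blinfun_apply (B n) (c *\<^sub>C x) = c *\<^sub>C blinfun_apply (B n) x" for n c x
    using selfadj_linear[OF sa] by (simp add: complex_linear_def)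
  ultimately show "complex_linear C"
    unfolding complex_linear_def by (metis (no_types, lifting) LIMSEQ_unique ext)
qed

lemma selfadj_fun_calc:
  assumes A: "positive_op A" and f: "continuous_on {0..norm A} f"
  shows "selfadj (fun_calc f A)"
proof -
  obtain q where q: "uniform_limit {0..norm A} (\<lambda>n. poly (q n)) f sequentially"
    using polynomial_approximation[OF f] by blast
  show ?thesis
    by (rule selfadj_limit[OF fun_calc_tendsto[OF A order_refl q]])
       (rule selfadj_op_poly[OF positive_op_selfadj[OF A]])
qed

text \<open>\<open>f(A)\<close> is the square of the self-adjoint operator \<open>\<surd>f(A)\<close>.\<close>

lemma positive_op_fun_calc:
  assumes A: "positive_op A" and f: "continuous_on {0..norm A} f"
    and pos: "\<And>t. 0 \<le> t \<Longrightarrow> t \<le> norm A \<Longrightarrow> 0 \<le> f t"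
  shows "positive_op (fun_calc f A)"
proof -
  let ?g = "\<lambda>t. sqrt (f t)"
  have g: "continuous_on {0..norm A} ?g" by (intro continuous_intros f)
  have sg: "selfadj (fun_calc ?g A)" by (rule selfadj_fun_calc[OF A g])
  have "fun_calc f A = fun_calc (\<lambda>t. ?g t * ?g t) A"
    by (rule fun_calc_cong[OF A f]) (simp add: pos)
  also have "\<dots> = fun_calc ?g A o\<^sub>L fun_calc ?g A" by (rule fun_calc_mult[OF A g g])
  finally have "re_cinner (blinfun_apply (fun_calc f A) x) x = (norm (blinfun_apply (fun_calc ?g A) x))\<^sup>2" for x
    by (simp add: selfadj_re_cinner[OF sg] re_cinner_self)
  then show ?thesis using selfadj_fun_calc[OF A f] by (simp add: positive_op_def)
qed

section \<open>Real powers of positive operators\<close>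

lemma continuous_on_powr_nonneg: "a > 0 \<Longrightarrow> continuous_on {0..R} (\<lambda>t::real. t powr a)"
  by (intro continuous_on_powr' continuous_intros) auto

lemma positive_op_powr: "positive_op A \<Longrightarrow> a > 0 \<Longrightarrow> positive_op (op_powr A a)"
  unfolding op_powr_def by (rule positive_op_fun_calc) (auto intro: continuous_on_powr_nonneg)

lemma op_powr_compose:
  assumes "positive_op A" "a > 0" "b > 0"
  shows "op_powr A a o\<^sub>L op_powr A b = op_powr A (a + b)"
  using assms unfolding op_powr_def
  by (subst fun_calc_mult[symmetric]) (auto simp: powr_add intro: continuous_on_powr_nonneg)

lemma op_powr_one:
  assumes A: "positive_op A" shows "op_powr A 1 = A"
proof -
  have "op_powr A 1 = fun_calc (poly [:0, 1:]) A"
    unfolding op_powr_def by (rule fun_calc_cong[OF A continuous_on_powr_nonneg]) simp_all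
  also have "\<dots> = A" by (simp add: fun_calc_poly[OF A] op_poly_pCons) (rule blinfun_eqI, simp)
  finally show ?thesis .
qed

text \<open>
  Statements about approximate eigenvectors replace the spectral theorem in this development:
  a sequence that is asymptotically an eigenvector of \<open>A\<close> for \<open>l\<close> is one of \<open>f(A)\<close> for \<open>f(l)\<close>, first for
  polynomials and then for powers.
\<close>

lemma op_poly_approx_eigenvector:
  assumes A: "(\<lambda>m. blinfun_apply A (x m) - l *\<^sub>R x m) \<longlonglongrightarrow> 0"
  shows "(\<lambda>m. blinfun_apply (op_poly q A) (x m) - poly q l *\<^sub>R x m) \<longlonglongrightarrow> 0"
proof (induction q)
  case (pCons c q)
  have "(\<lambda>m. blinfun_apply A (blinfun_apply (op_poly q A) (x m) - poly q l *\<^sub>R x m)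
      + poly q l *\<^sub>R (blinfun_apply A (x m) - l *\<^sub>R x m)) \<longlonglongrightarrow> blinfun_apply A 0 + poly q l *\<^sub>R 0"
    by (intro tendsto_intros pCons.IH A)
  then show ?case
    by (simp add: op_poly_pCons blinfun.add_left blinfun.scaleR_left blinfun.diff_right
        blinfun.scaleR_right algebra_simps)
qed simp

text \<open>
  The interval of approximation is chosen to contain \<open>l\<close> as well as the spectrum, so that one
  polynomial is close to the power both at the operator and at the number \<open>l\<close>.
\<close>

lemma op_powr_approx_eigenvector:
  fixes A :: "'a::complex_hilbert_space \<Rightarrow>\<^sub>L 'a"
  assumes A: "positive_op A" and a: "a > 0" and l: "l \<ge> 0" and K: "\<And>m. norm (x m) \<le> K"
    and lim: "(\<lambda>m. blinfun_apply A (x m) - l *\<^sub>R x m) \<longlonglongrightarrow> 0"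
  shows "(\<lambda>m. blinfun_apply (op_powr A a) (x m) - (l powr a) *\<^sub>R x m) \<longlonglongrightarrow> 0"
proof (rule LIMSEQ_I)
  fix e :: real assume e: "e > 0"
  define R where "R = max (norm A) l"
  have K0: "K + 1 > 0" using K[of 0] norm_ge_zero[of "x 0"] by linarith
  obtain q where q: "uniform_limit {0..R} (\<lambda>n. poly (q n)) (\<lambda>t. t powr a) sequentially"
    using polynomial_approximation[OF continuous_on_powr_nonneg[OF a]] by blast
  \<comment> \<open>each of the three error terms below then contributes at most \<open>e / 3\<close>; \<open>K + 1\<close> is positive even if \<open>K = 0\<close>\<close>
  define d where "d = e / (3 * (K + 1))"
  have d: "d > 0" using e K0 by (simp add: d_def)
  have "(\<lambda>n. op_poly (q n) A) \<longlonglongrightarrow> op_powr A a"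
    unfolding op_powr_def by (rule fun_calc_tendsto[OF A _ q]) (simp add: R_def)
  then have "\<forall>\<^sub>F n in sequentially. dist (op_poly (q n) A) (op_powr A a) < d"
    using d by (rule tendstoD)
  moreover have "\<forall>\<^sub>F n in sequentially. \<forall>t\<in>{0..R}. dist (poly (q n) t) (t powr a) < d"
    by (rule uniform_limitD[OF q d])
  ultimately have "\<forall>\<^sub>F n in sequentially. dist (op_poly (q n) A) (op_powr A a) < d \<and> dist (poly (q n) l) (l powr a) < d"
    by eventually_elim (use l in \<open>auto simp: R_def\<close>)
  then obtain n where n: "norm (op_powr A a - op_poly (q n) A) < d" "\<bar>poly (q n) l - l powr a\<bar> < d"
    by (auto simp: eventually_sequentially dist_norm norm_minus_commute)
  obtain M where M: "\<And>m. m \<ge> M \<Longrightarrow> norm (blinfun_apply (op_poly (q n) A) (x m) - poly (q n) l *\<^sub>R x m) < e / 3"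
    using LIMSEQ_D[OF op_poly_approx_eigenvector[OF lim, of "q n"], of "e / 3"] e by auto
  have "norm (blinfun_apply (op_powr A a) (x m) - (l powr a) *\<^sub>R x m) < e" if "m \<ge> M" for m
  proof -
    have dK: "d * norm (x m) \<le> e / 3"
    proof -
      have "d * norm (x m) \<le> d * (K + 1)" using K[of m] d by (intro mult_left_mono) auto
      also have "\<dots> = e / 3" using K0 by (simp add: d_def divide_simps)
      finally show ?thesis .
    qed
    have "norm (blinfun_apply (op_powr A a - op_poly (q n) A) (x m)) \<le> norm (op_powr A a - op_poly (q n) A) * norm (x m)"
      by (rule norm_blinfun)
    also have "\<dots> \<le> d * norm (x m)" using n(1) by (intro mult_right_mono) auto
    finally have 1: "norm (blinfun_apply (op_powr A a - op_poly (q n) A) (x m)) \<le> e / 3" using dK by linarith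
    have "norm ((poly (q n) l - l powr a) *\<^sub>R x m) \<le> d * norm (x m)"
      using n(2) by (simp add: mult_right_mono)
    then have 2: "norm ((poly (q n) l - l powr a) *\<^sub>R x m) \<le> e / 3" using dK by linarith
    let ?u = "blinfun_apply (op_powr A a - op_poly (q n) A) (x m)"
      and ?v = "blinfun_apply (op_poly (q n) A) (x m) - poly (q n) l *\<^sub>R x m"
      and ?w = "(poly (q n) l - l powr a) *\<^sub>R x m"
    have split: "blinfun_apply (op_powr A a) (x m) - (l powr a) *\<^sub>R x m = ?u + ?v + ?w"
      by (simp add: blinfun.diff_left algebra_simps)
    have "norm (?u + ?v + ?w) \<le> norm ?u + norm ?v + norm ?w"
      by (rule order_trans[OF norm_triangle_ineq add_right_mono[OF norm_triangle_ineq]])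
    then show ?thesis unfolding split using 1 2 M[OF that] by linarith
  qed
  then show "\<exists>M. \<forall>m\<ge>M. norm (blinfun_apply (op_powr A a) (x m) - (l powr a) *\<^sub>R x m - 0) < e"
    by auto
qed

lemma op_powr_eigenvector:
  assumes A: "positive_op A" "a > 0" "l \<ge> 0" and x: "blinfun_apply A x = l *\<^sub>R x"
  shows "blinfun_apply (op_powr A a) x = (l powr a) *\<^sub>R x"
proof -
  have "(\<lambda>_::nat. blinfun_apply (op_powr A a) x - (l powr a) *\<^sub>R x) \<longlonglongrightarrow> 0"
    by (rule op_powr_approx_eigenvector[OF A, of "\<lambda>_. x" "norm x"]) (simp_all add: x)
  then show ?thesis by (simp add: LIMSEQ_const_iff)
qed

lemma positive_op_compose_commuting_projection:
  assumes A: "positive_op A" and Q: "selfadj Q" "Q o\<^sub>L Q = Q" and comm: "A o\<^sub>L Q = Q o\<^sub>L A"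
  shows "positive_op (A o\<^sub>L Q)"
proof -
  note sa = selfadj_re_cinner[OF positive_op_selfadj[OF A]] selfadj_re_cinner[OF Q(1)]
  have comm': "blinfun_apply A (blinfun_apply Q x) = blinfun_apply Q (blinfun_apply A x)" for x
    using comm by (metis blinfun_apply_blinfun_compose)
  have QQ: "blinfun_apply Q (blinfun_apply Q x) = blinfun_apply Q x" for x
    using Q(2) by (metis blinfun_apply_blinfun_compose)
  have "selfadj (A o\<^sub>L Q)"
  proof (rule selfadjI)
    show "complex_linear (A o\<^sub>L Q)" using A Q(1) by (simp add: positive_op_selfadj selfadj_linear)
    show "re_cinner (blinfun_apply (A o\<^sub>L Q) x) y = re_cinner x (blinfun_apply (A o\<^sub>L Q) y)" for x y
      by (simp add: sa comm')
  qed
  moreover have "re_cinner (blinfun_apply (A o\<^sub>L Q) x) x = re_cinner (blinfun_apply A (blinfun_apply Q x)) (blinfun_apply Q x)" for x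
    by (simp add: sa comm' QQ flip: sa(2))
  ultimately show ?thesis using A by (simp add: positive_op_def)
qed

text \<open>
  For polynomials, \<open>q(AQ) = q(A)Q + q(0)(1 - Q)\<close>; the second term disappears in the limit because
  \<open>0 powr a = 0\<close>. This transfers paranormality to the part of an operator on a reducing subspace
  without leaving the ambient space.
\<close>

lemma op_powr_compose_commuting_projection:
  fixes A :: "'a::complex_hilbert_space \<Rightarrow>\<^sub>L 'a"
  assumes A: "positive_op A" and Q: "selfadj Q" "Q o\<^sub>L Q = Q" and comm: "A o\<^sub>L Q = Q o\<^sub>L A" and a: "a > 0"
  shows "op_powr (A o\<^sub>L Q) a = op_powr A a o\<^sub>L Q"
proof -
  define R where "R = max (norm A) (norm (A o\<^sub>L Q))"
  have comm': "blinfun_apply A (blinfun_apply Q x) = blinfun_apply Q (blinfun_apply A x)" for x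
    using comm by (metis blinfun_apply_blinfun_compose)
  have QQ: "blinfun_apply Q (blinfun_apply Q x) = blinfun_apply Q x" for x
    using Q(2) by (metis blinfun_apply_blinfun_compose)
  have poly_comm: "blinfun_apply Q (blinfun_apply (op_poly q A) x) = blinfun_apply (op_poly q A) (blinfun_apply Q x)" for q x
    by (induction q) (simp_all add: op_poly_pCons blinfun.add_left blinfun.add_right
        blinfun.scaleR_left blinfun.scaleR_right blinfun.zero_right flip: comm')
  have poly_Q: "op_poly q (A o\<^sub>L Q) = (op_poly q A o\<^sub>L Q) + poly q 0 *\<^sub>R (id_blinfun - Q)" for q
  proof (rule blinfun_eqI)
    show "blinfun_apply (op_poly q (A o\<^sub>L Q)) x
        = blinfun_apply ((op_poly q A o\<^sub>L Q) + poly q 0 *\<^sub>R (id_blinfun - Q)) x" for x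
      by (induction q) (simp_all add: op_poly_pCons blinfun.add_left blinfun.add_right blinfun.diff_left
        blinfun.scaleR_left blinfun.scaleR_right blinfun.diff_right poly_comm QQ scaleR_diff_right)
  qed
  obtain q where q: "uniform_limit {0..R} (\<lambda>n. poly (q n)) (\<lambda>t. t powr a) sequentially"
    using polynomial_approximation[OF continuous_on_powr_nonneg[OF a]] by blast
  have "(0::real) \<in> {0..R}" by (simp add: R_def le_max_iff_disj)
  from tendsto_uniform_limitI[OF q this] have q0: "(\<lambda>n. poly (q n) 0) \<longlonglongrightarrow> 0" by simp
  have "(\<lambda>n. op_poly (q n) A) \<longlonglongrightarrow> op_powr A a"
    unfolding op_powr_def by (rule fun_calc_tendsto[OF A _ q]) (simp add: R_def)
  then have "(\<lambda>n. (op_poly (q n) A o\<^sub>L Q) + poly (q n) 0 *\<^sub>R (id_blinfun - Q))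
      \<longlonglongrightarrow> (op_powr A a o\<^sub>L Q) + 0 *\<^sub>R (id_blinfun - Q)"
    by (intro tendsto_add tendsto_scaleR blinfun_compose.tendsto tendsto_const q0)
  moreover have "(\<lambda>n. op_poly (q n) (A o\<^sub>L Q)) \<longlonglongrightarrow> op_powr (A o\<^sub>L Q) a"
    unfolding op_powr_def
    by (rule fun_calc_tendsto[OF positive_op_compose_commuting_projection[OF A Q comm] _ q]) (simp add: R_def)
  ultimately show ?thesis using LIMSEQ_unique by (simp add: poly_Q)
qed

section \<open>Absolute values and norms\<close>

lemma re_cinner_adj_compose:
  assumes "complex_linear T"
  shows "re_cinner (blinfun_apply (adj T) (blinfun_apply T x)) x = (norm (blinfun_apply T x))\<^sup>2"
  using re_cinner_adj'[OF assms, of "blinfun_apply T x" x] by (simp add: re_cinner_self)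

lemma positive_op_adj_compose:
  assumes T: "complex_linear T" shows "positive_op (adj T o\<^sub>L T)"
  unfolding positive_op_def
proof (intro conjI allI)
  show "selfadj (adj T o\<^sub>L T)"
    using T by (intro selfadjI) (simp_all add: re_cinner_adj')
  show "0 \<le> re_cinner (blinfun_apply (adj T o\<^sub>L T) x) x" for x
    by (simp add: re_cinner_adj_compose[OF T])
qed

lemma positive_op_abs: "complex_linear T \<Longrightarrow> positive_op (op_abs T)"
  unfolding op_abs_def by (intro positive_op_powr positive_op_adj_compose) auto

lemma op_abs_squared: "complex_linear T \<Longrightarrow> op_abs T o\<^sub>L op_abs T = adj T o\<^sub>L T"
  unfolding op_abs_def by (simp add: op_powr_compose op_powr_one positive_op_adj_compose)

lemma norm_op_abs_apply:
  assumes T: "complex_linear T"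
  shows "norm (blinfun_apply (op_abs T) x) = norm (blinfun_apply T x)"
proof -
  have "(norm (blinfun_apply (op_abs T) x))\<^sup>2 = re_cinner (blinfun_apply (op_abs T o\<^sub>L op_abs T) x) x"
    by (simp add: re_cinner_self selfadj_re_cinner[OF positive_op_selfadj[OF positive_op_abs[OF T]]])
  also have "\<dots> = (norm (blinfun_apply T x))\<^sup>2"
    by (simp add: op_abs_squared[OF T] re_cinner_adj_compose[OF T])
  finally show ?thesis by simp
qed

lemma norm_adj_apply_le:
  assumes T: "complex_linear T"
  shows "norm (blinfun_apply (adj T) y) \<le> norm T * norm y"
proof -
  have "(norm (blinfun_apply (adj T) y))\<^sup>2 = re_cinner (blinfun_apply T (blinfun_apply (adj T) y)) y"
    by (simp add: re_cinner_adj[OF T] re_cinner_self)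
  also have "\<dots> \<le> norm (blinfun_apply T (blinfun_apply (adj T) y)) * norm y"
    using re_cinner_abs_le abs_le_D1 by blast
  also have "\<dots> \<le> norm T * norm (blinfun_apply (adj T) y) * norm y"
    by (intro mult_right_mono norm_blinfun norm_ge_zero)
  finally have "norm (blinfun_apply (adj T) y) * norm (blinfun_apply (adj T) y)
      \<le> norm (blinfun_apply (adj T) y) * (norm T * norm y)"
    by (simp add: power2_eq_square mult_ac)
  then show ?thesis by (cases "norm (blinfun_apply (adj T) y) = 0") auto
qed

lemma norm_adj: "complex_linear T \<Longrightarrow> norm (adj T) = norm T"
  using norm_blinfun_bound[OF norm_ge_zero norm_adj_apply_le[of T]]
    norm_blinfun_bound[OF norm_ge_zero norm_adj_apply_le[of "adj T"]] by force

text \<open>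
  Expanding the square shows that \<open>x\<close> is nearly an eigenvector of \<open>T\<^sup>*T\<close> for \<open>\<parallel>T\<parallel>\<^sup>2\<close> as soon as it nearly
  attains the norm of \<open>T\<close>.
\<close>

lemma adj_compose_defect:
  assumes T: "complex_linear T"
  shows "(norm (blinfun_apply (adj T) (blinfun_apply T x) - (norm T)\<^sup>2 *\<^sub>R x))\<^sup>2
    \<le> (norm T)\<^sup>2 * ((norm T)\<^sup>2 * (norm x)\<^sup>2 - (norm (blinfun_apply T x))\<^sup>2)"
proof -
  have "(norm (blinfun_apply (adj T) (blinfun_apply T x)))\<^sup>2 \<le> (norm T * norm (blinfun_apply T x))\<^sup>2"
    by (intro power_mono norm_adj_apply_le T norm_ge_zero)
  then show ?thesis
    by (simp add: norm_diff_sq re_cinner.scaleR_right re_cinner_adj_compose[OF T] power_mult_distrib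
        power2_eq_square[of "(norm T)\<^sup>2"] right_diff_distrib)
qed

text \<open>
  In terms of \<open>s = (t / c)\<^sup>2 \<in> [0, 1]\<close> this is \<open>s\<^sup>p \<le> 1 - min 1 p (1 - s)\<close>: the tangent at \<open>1\<close> of a concave
  function if \<open>p \<le> 1\<close>, and \<open>s\<^sup>p \<le> s\<close> if \<open>p > 1\<close>.
\<close>

lemma powr_tangent_bound:
  fixes c p t :: real
  assumes p: "p > 0" and t: "0 \<le> t" "t \<le> c" and c: "c > 0"
  shows "t powr (2 * p) \<le> c powr (2 * p) - min 1 p * c powr (2 * p - 2) * (c\<^sup>2 - t\<^sup>2)"
proof (cases "t = 0")
  case True
  have "c powr (2 * p - 2) * c\<^sup>2 = c powr (2 * p)"
    using c by (simp add: powr_diff powr_numeral)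
  then have "min 1 p * c powr (2 * p - 2) * (c\<^sup>2 - t\<^sup>2) = min 1 p * c powr (2 * p)"
    using True by (simp add: mult.assoc)
  also have "\<dots> \<le> 1 * c powr (2 * p)" by (intro mult_right_mono) auto
  finally show ?thesis using True p by simp
next
  case False
  define s where "s = (t / c)\<^sup>2"
  have s: "0 < s" "s \<le> 1"
    using t c False by (auto simp: s_def power_le_one divide_le_eq)
  have "s powr p \<le> 1 - min 1 p * (1 - s)"
  proof (cases "p \<le> 1")
    case True
    then show ?thesis
      using Youngs_inequality_0[of p "1 - p" s 1] p s by (simp add: algebra_simps)
  next
    case False
    then have "s powr p \<le> s powr 1" using s by (intro powr_mono') auto
    then show ?thesis using False s by simp
  qed
  then have "c powr (2 * p) * s powr p \<le> c powr (2 * p) * (1 - min 1 p * (1 - s))"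
    by (intro mult_left_mono) auto
  moreover have "c powr (2 * p) * s powr p = t powr (2 * p)"
  proof -
    have "s = (t / c) powr 2" using t c False by (simp add: s_def powr_numeral)
    then have "s powr p = (t / c) powr (2 * p)" by (simp add: powr_powr)
    then show ?thesis using t c False by (simp add: powr_divide)
  qed
  moreover have "c powr (2 * p) * (1 - s) = c powr (2 * p - 2) * (c\<^sup>2 - t\<^sup>2)"
    using c by (simp add: s_def powr_diff powr_numeral power_divide field_simps)
  then have "c powr (2 * p) * (min 1 p * (1 - s)) = min 1 p * c powr (2 * p - 2) * (c\<^sup>2 - t\<^sup>2)"
    by (simp add: mult.left_commute mult.assoc)
  ultimately show ?thesis by (simp add: right_diff_distrib)
qed

text \<open>
  The scalar inequality, transported by positivity of the functional calculus: if \<open>\<parallel>B\<^sup>p x\<parallel>\<close> is close to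
  its maximum \<open>c\<^sup>p \<parallel>x\<parallel>\<close>, then \<open>\<parallel>B x\<parallel>\<close> is close to \<open>c \<parallel>x\<parallel>\<close>.
\<close>

lemma op_powr_defect_bound:
  fixes B :: "'a::complex_hilbert_space \<Rightarrow>\<^sub>L 'a"
  assumes B: "positive_op B" and c: "norm B \<le> c" "c > 0" and p: "p > 0"
  shows "(norm (blinfun_apply (op_powr B p) x))\<^sup>2 \<le> c powr (2 * p) * (norm x)\<^sup>2
    - min 1 p * c powr (2 * p - 2) * (c\<^sup>2 * (norm x)\<^sup>2 - (norm (blinfun_apply B x))\<^sup>2)"
proof -
  define k where "k = min 1 p * c powr (2 * p - 2)"
  define q where "q = [:c powr (2 * p) - k * c\<^sup>2, 0, k:]"
  have sB: "selfadj B" and sP: "selfadj (op_powr B p)"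
    using B positive_op_powr[OF B p] by (simp_all add: positive_op_selfadj)
  have cq: "continuous_on {0..norm B} (poly q)" by (intro continuous_intros)
  have cp: "continuous_on {0..norm B} (\<lambda>t. t powr (2 * p))"
    using p by (intro continuous_on_powr_nonneg) simp
  have "positive_op (fun_calc (\<lambda>t. poly q t - t powr (2 * p)) B)"
  proof (rule positive_op_fun_calc[OF B])
    show "continuous_on {0..norm B} (\<lambda>t. poly q t - t powr (2 * p))"
      by (intro continuous_on_diff cq cp)
    show "0 \<le> poly q t - t powr (2 * p)" if "0 \<le> t" "t \<le> norm B" for t
      using powr_tangent_bound[OF p that(1) _ c(2)] that(2) c(1)
      by (simp add: q_def k_def algebra_simps power2_eq_square)
  qed
  moreover have "fun_calc (\<lambda>t. poly q t - t powr (2 * p)) B = op_poly q B - (op_powr B p o\<^sub>L op_powr B p)"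
    using op_powr_compose[OF B p p]
    by (simp add: fun_calc_diff[OF B cq cp] fun_calc_poly[OF B] op_powr_def)
  ultimately have "0 \<le> re_cinner (blinfun_apply (op_poly q B - (op_powr B p o\<^sub>L op_powr B p)) x) x"
    by (simp add: positive_op_def)
  also have "\<dots> = (c powr (2 * p) - k * c\<^sup>2) * (norm x)\<^sup>2 + k * (norm (blinfun_apply B x))\<^sup>2
      - (norm (blinfun_apply (op_powr B p) x))\<^sup>2"
    by (simp add: q_def op_poly_pCons blinfun.diff_left blinfun.add_left blinfun.scaleR_left
        blinfun.scaleR_right re_cinner.diff_left re_cinner.add_left re_cinner.scaleR_left
        selfadj_re_cinner[OF sB] selfadj_re_cinner[OF sP] re_cinner_self)
  finally show ?thesis by (simp add: k_def algebra_simps)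
qed

section \<open>Absolute-paranormal operators are normaloid\<close>

lemma absolute_paranormal_homogeneous:
  fixes T :: "'a::complex_hilbert_space \<Rightarrow>\<^sub>L 'a"
  assumes ap: "absolute_paranormal p r T" and p: "p > 0" and r: "r > 0"
  shows "norm (blinfun_apply (op_powr (op_abs (adj T)) r) x) powr (p + r)
    \<le> norm (blinfun_apply (op_powr (op_abs T) p) (blinfun_apply (op_powr (op_abs (adj T)) r) x)) powr r
       * norm x powr p"
proof (cases "x = 0")
  case False
  define n where "n = norm x"
  have n: "n > 0" using False by (simp add: n_def)
  define u where "u = (1 / n) *\<^sub>R x"
  have u: "norm u = 1" "x = n *\<^sub>R u" using n by (simp_all add: u_def n_def)
  let ?W = "op_powr (op_abs (adj T)) r" and ?P = "op_powr (op_abs T) p"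
  have "norm (blinfun_apply ?W u) powr (p + r) \<le> norm (blinfun_apply ?P (blinfun_apply ?W u)) powr r"
    using ap u(1) by (simp add: absolute_paranormal_def)
  then have "n powr (p + r) * norm (blinfun_apply ?W u) powr (p + r)
      \<le> n powr (p + r) * norm (blinfun_apply ?P (blinfun_apply ?W u)) powr r"
    by (intro mult_left_mono) auto
  then show ?thesis
    using n u(1) by (simp add: u(2) blinfun.scaleR_right powr_mult powr_add mult_ac)
qed (use p r in \<open>simp add: blinfun.zero_right\<close>)

text \<open>
  The heart of the matter. Approximate eigenvectors of \<open>TT\<^sup>*\<close> are approximate eigenvectors of \<open>|T\<^sup>*|\<^sup>r\<close>,
  for \<open>c\<^sup>r\<close>. Substituting this into the paranormality inequality leaves \<open>\<parallel>|T|\<^sup>p x\<^sub>m\<parallel>\<close>, which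
  is bounded below by a sequence with limit \<open>c\<^sup>p\<close>. By \<open>op_powr_defect_bound\<close> the norm of \<open>T\<close> is nearly
  attained at \<open>x\<^sub>m\<close>, and \<open>adj_compose_defect\<close> concludes.
\<close>

lemma absolute_paranormal_approx_eigenvector:
  fixes T :: "'a::complex_hilbert_space \<Rightarrow>\<^sub>L 'a"
  assumes T: "complex_linear T" and ap: "absolute_paranormal p r T" and p: "p > 0" and r: "r > 0"
    and T0: "T \<noteq> 0" and x1: "(\<lambda>m. norm (x m)) \<longlonglongrightarrow> 1"
    and lim: "(\<lambda>m. blinfun_apply T (blinfun_apply (adj T) (x m)) - (norm T)\<^sup>2 *\<^sub>R x m) \<longlonglongrightarrow> 0"
  shows "(\<lambda>m. blinfun_apply (adj T) (blinfun_apply T (x m)) - (norm T)\<^sup>2 *\<^sub>R x m) \<longlonglongrightarrow> 0"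
proof -
  define c where "c = norm T"
  have c: "c > 0" using T0 by (simp add: c_def)
  define W where "W = op_powr (op_abs (adj T)) r"
  define P where "P = op_powr (op_abs T) p"
  have posS: "positive_op (op_abs (adj T))" by (rule positive_op_abs) (simp add: T)
  obtain K where K: "\<And>m. norm (x m) \<le> K"
    using convergent_imp_Bseq[OF convergentI[OF x1]] by (auto simp: Bseq_def)
  have "(\<lambda>m. blinfun_apply (op_abs (adj T)) (x m) - ((c\<^sup>2) powr (1/2)) *\<^sub>R x m) \<longlonglongrightarrow> 0"
    unfolding op_abs_def
    by (rule op_powr_approx_eigenvector[OF positive_op_adj_compose _ _ K])
       (use lim in \<open>simp_all add: T c_def\<close>)
  moreover have "(c\<^sup>2) powr (1/2) = c" using c by (simp add: powr_half_sqrt)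
  ultimately have Wlim: "(\<lambda>m. blinfun_apply W (x m) - (c powr r) *\<^sub>R x m) \<longlonglongrightarrow> 0"
    unfolding W_def using c by (intro op_powr_approx_eigenvector[OF posS r _ K]) simp_all
  have diff_norm: "(\<lambda>m. norm (a m) - norm (b m)) \<longlonglongrightarrow> 0"
    if "(\<lambda>m. a m - b m) \<longlonglongrightarrow> 0" for a b :: "nat \<Rightarrow> 'a"
    by (rule tendsto_0_le[OF that, of _ 1]) (simp add: norm_triangle_ineq3)
  \<comment> \<open>paranormality compares \<open>v\<close> with \<open>w\<close>; asymptotically \<open>w\<close> is \<open>c\<^sup>r\<close> and \<open>v\<close> is \<open>c\<^sup>r u\<close>\<close>
  define w where "w = (\<lambda>m. norm (blinfun_apply W (x m)))"
  define v where "v = (\<lambda>m. norm (blinfun_apply P (blinfun_apply W (x m))))"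
  define u where "u = (\<lambda>m. norm (blinfun_apply P (x m)))"
  have wlim: "w \<longlonglongrightarrow> c powr r"
  proof -
    have "(\<lambda>m. (w m - c powr r * norm (x m)) + c powr r * norm (x m)) \<longlonglongrightarrow> 0 + c powr r * 1"
      using diff_norm[OF Wlim] by (intro tendsto_intros x1) (simp add: w_def)
    then show ?thesis by simp
  qed
  have vu: "(\<lambda>m. v m - c powr r * u m) \<longlonglongrightarrow> 0"
  proof -
    have "(\<lambda>m. blinfun_apply P (blinfun_apply W (x m) - (c powr r) *\<^sub>R x m)) \<longlonglongrightarrow> blinfun_apply P 0"
      by (intro tendsto_intros Wlim)
    then have "(\<lambda>m. blinfun_apply P (blinfun_apply W (x m)) - (c powr r) *\<^sub>R blinfun_apply P (x m)) \<longlonglongrightarrow> 0"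
      by (simp add: blinfun.diff_right blinfun.scaleR_right)
    from diff_norm[OF this] show ?thesis by (simp add: v_def u_def)
  qed
  \<comment> \<open>\<open>L\<close> bounds \<open>v\<close> from below by the paranormality inequality, and \<open>l\<close> is the resulting bound for \<open>u\<close>\<close>
  define L where "L = (\<lambda>m. (w m powr (p + r) / norm (x m) powr p) powr (1 / r))"
  have "L \<longlonglongrightarrow> ((c powr r) powr (p + r) / 1 powr p) powr (1 / r)"
    unfolding L_def using c r by (intro tendsto_intros wlim x1) auto
  moreover have "((c powr r) powr (p + r) / 1 powr p) powr (1 / r) = c powr (p + r)"
    using r by (simp add: powr_powr)
  ultimately have Llim: "L \<longlonglongrightarrow> c powr (p + r)" by simp
  have x_pos: "\<forall>\<^sub>F m in sequentially. norm (x m) > 0"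
    by (rule order_tendstoD(1)[OF x1]) simp
  have L_le: "L m \<le> v m" if "norm (x m) > 0" for m
  proof -
    have "w m powr (p + r) \<le> v m powr r * norm (x m) powr p"
      using absolute_paranormal_homogeneous[OF ap p r, of "x m"] by (simp add: w_def v_def W_def P_def)
    then have "w m powr (p + r) / norm (x m) powr p \<le> v m powr r"
      using that by (simp add: pos_divide_le_eq)
    then have "L m \<le> (v m powr r) powr (1 / r)"
      unfolding L_def using r by (intro powr_mono2) auto
    then show ?thesis using r by (simp add: powr_powr v_def)
  qed
  define l where "l = (\<lambda>m. (L m - (v m - c powr r * u m)) / c powr r)"
  have "l \<longlonglongrightarrow> (c powr (p + r) - 0) / c powr r"
    unfolding l_def using c by (intro tendsto_intros Llim vu) auto
  moreover have "(c powr (p + r) - 0) / c powr r = c powr p" using c by (simp add: powr_add)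
  ultimately have llim: "l \<longlonglongrightarrow> c powr p" by simp
  have l_pos: "\<forall>\<^sub>F m in sequentially. l m > 0"
    by (rule order_tendstoD(1)[OF llim]) (use c in simp)
  define d where "d = (\<lambda>m. c\<^sup>2 * (norm (x m))\<^sup>2 - (norm (blinfun_apply T (x m)))\<^sup>2)"
  define k where "k = min 1 p * c powr (2 * p - 2)"
  have k: "k > 0" using p c by (simp add: k_def)
  have d_nonneg: "0 \<le> d m" for m
    using power_mono[OF norm_blinfun[of T "x m"], of 2] by (simp add: d_def c_def power_mult_distrib)
  have kd: "k * d m \<le> c powr (2 * p) * (norm (x m))\<^sup>2 - (u m)\<^sup>2" for m
  proof -
    have "norm (op_abs T) \<le> c"
      unfolding c_def by (rule norm_blinfun_bound) (simp_all add: norm_op_abs_apply[OF T] norm_blinfun)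
    from op_powr_defect_bound[OF positive_op_abs[OF T] this c p, of "x m"] show ?thesis
      by (simp add: k_def d_def u_def P_def norm_op_abs_apply[OF T])
  qed
  have dlim: "d \<longlonglongrightarrow> 0"
  proof (rule tendsto_sandwich[OF _ _ tendsto_const])
    show "\<forall>\<^sub>F m in sequentially. 0 \<le> d m" using d_nonneg by simp
    show "\<forall>\<^sub>F m in sequentially. d m \<le> (c powr (2 * p) * (norm (x m))\<^sup>2 - (l m)\<^sup>2) / k"
      using x_pos l_pos
    proof eventually_elim
      case (elim m)
      have "l m \<le> u m" using L_le[OF elim(1)] c by (simp add: l_def pos_divide_le_eq mult.commute)
      then have "(l m)\<^sup>2 \<le> (u m)\<^sup>2" using elim(2) by (intro power_mono) auto
      then show ?case using kd[of m] k by (simp add: pos_le_divide_eq mult.commute)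
    qed
    have "(\<lambda>m. (c powr (2 * p) * (norm (x m))\<^sup>2 - (l m)\<^sup>2) / k)
        \<longlonglongrightarrow> (c powr (2 * p) * 1\<^sup>2 - (c powr p)\<^sup>2) / k"
      using k by (intro tendsto_intros x1 llim) auto
    moreover have "(c powr p)\<^sup>2 = c powr (2 * p)"
      by (simp add: power2_eq_square flip: powr_add)
    ultimately show "(\<lambda>m. (c powr (2 * p) * (norm (x m))\<^sup>2 - (l m)\<^sup>2) / k) \<longlonglongrightarrow> 0" by simp
  qed
  let ?D = "\<lambda>m. blinfun_apply (adj T) (blinfun_apply T (x m)) - c\<^sup>2 *\<^sub>R x m"
  have "(\<lambda>m. (norm (?D m))\<^sup>2) \<longlonglongrightarrow> 0"
  proof (rule tendsto_sandwich[OF _ _ tendsto_const])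
    show "\<forall>\<^sub>F m in sequentially. 0 \<le> (norm (?D m))\<^sup>2" by simp
    show "\<forall>\<^sub>F m in sequentially. (norm (?D m))\<^sup>2 \<le> c\<^sup>2 * d m"
      using adj_compose_defect[OF T] by (simp add: c_def d_def)
    show "(\<lambda>m. c\<^sup>2 * d m) \<longlonglongrightarrow> 0" using tendsto_mult_right_zero[OF dlim] .
  qed
  then have "(\<lambda>m. sqrt ((norm (?D m))\<^sup>2)) \<longlonglongrightarrow> sqrt 0" by (rule tendsto_real_sqrt)
  then show ?thesis by (simp add: tendsto_norm_zero_iff c_def)
qed

text \<open>Unit vectors on which \<open>T\<^sup>*\<close> nearly attains its norm qualify, by \<open>adj_compose_defect\<close> for \<open>T\<^sup>*\<close>.\<close>

lemma norm_adj_attained_approx: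
  fixes T :: "'a::complex_hilbert_space \<Rightarrow>\<^sub>L 'a"
  assumes T: "complex_linear T" and T0: "T \<noteq> 0"
  shows "\<exists>x :: nat \<Rightarrow> 'a. (\<forall>m. norm (x m) = 1) \<and>
    (\<lambda>m. blinfun_apply T (blinfun_apply (adj T) (x m)) - (norm T)\<^sup>2 *\<^sub>R x m) \<longlonglongrightarrow> 0"
proof -
  define c where "c = norm T"
  have c: "c > 0" using T0 by (simp add: c_def)
  have "\<exists>x. norm x = 1 \<and> c - 1 / real (Suc m) \<le> norm (blinfun_apply (adj T) x)" for m
  proof -
    define b where "b = max 0 (c - 1 / real (Suc m))"
    have "b < c" using c by (simp add: b_def)
    then have "\<not> norm (adj T) \<le> b" by (simp add: norm_adj[OF T] c_def)
    then obtain y where y: "b * norm y < norm (blinfun_apply (adj T) y)"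
      using norm_blinfun_bound[of b "adj T"] by (metis b_def max.cobounded1 not_le)
    then have y0: "norm y > 0" by (cases "y = 0") (auto simp: blinfun.zero_right)
    have "b \<le> norm (blinfun_apply (adj T) ((1 / norm y) *\<^sub>R y))"
      using y y0 by (simp add: blinfun.scaleR_right pos_le_divide_eq)
    then show ?thesis using y0 by (intro exI[of _ "(1 / norm y) *\<^sub>R y"]) (auto simp: b_def)
  qed
  then obtain x where x: "\<And>m. norm (x m) = 1"
    and low: "\<And>m. c - 1 / real (Suc m) \<le> norm (blinfun_apply (adj T) (x m))" by metis
  have lim: "(\<lambda>m. norm (blinfun_apply (adj T) (x m))) \<longlonglongrightarrow> c"
  proof (rule tendsto_sandwich)
    show "\<forall>\<^sub>F m in sequentially. c - 1 / real (Suc m) \<le> norm (blinfun_apply (adj T) (x m))"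
      using low by simp
    show "\<forall>\<^sub>F m in sequentially. norm (blinfun_apply (adj T) (x m)) \<le> c"
      using norm_adj_apply_le[OF T, of "x _"] by (simp add: x c_def)
    have "(\<lambda>m. c - 1 / real (Suc m)) \<longlonglongrightarrow> c - 0"
      by (intro tendsto_intros LIMSEQ_Suc[OF lim_1_over_n])
    then show "(\<lambda>m. c - 1 / real (Suc m)) \<longlonglongrightarrow> c" by simp
    show "(\<lambda>m. c) \<longlonglongrightarrow> c" by (rule tendsto_const)
  qed
  let ?D = "\<lambda>m. blinfun_apply T (blinfun_apply (adj T) (x m)) - c\<^sup>2 *\<^sub>R x m"
  have "(\<lambda>m. (norm (?D m))\<^sup>2) \<longlonglongrightarrow> 0"
  proof (rule tendsto_sandwich[OF _ _ tendsto_const])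
    show "\<forall>\<^sub>F m in sequentially. 0 \<le> (norm (?D m))\<^sup>2" by simp
    show "\<forall>\<^sub>F m in sequentially. (norm (?D m))\<^sup>2 \<le> c\<^sup>2 * (c\<^sup>2 - (norm (blinfun_apply (adj T) (x m)))\<^sup>2)"
      using adj_compose_defect[of "adj T" "x _"] T by (simp add: c_def norm_adj x)
    have "(\<lambda>m. c\<^sup>2 * (c\<^sup>2 - (norm (blinfun_apply (adj T) (x m)))\<^sup>2)) \<longlonglongrightarrow> c\<^sup>2 * (c\<^sup>2 - c\<^sup>2)"
      by (intro tendsto_intros lim)
    then show "(\<lambda>m. c\<^sup>2 * (c\<^sup>2 - (norm (blinfun_apply (adj T) (x m)))\<^sup>2)) \<longlonglongrightarrow> 0" by simp
  qed
  then have "(\<lambda>m. sqrt ((norm (?D m))\<^sup>2)) \<longlonglongrightarrow> sqrt 0" by (rule tendsto_real_sqrt)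
  then show ?thesis using x by (intro exI[of _ x]) (simp add: tendsto_norm_zero_iff c_def)
qed

text \<open>
  The hypotheses of \<open>absolute_paranormal_approx_eigenvector\<close> pass from \<open>x\<^sub>m\<close> to \<open>T x\<^sub>m / c\<close>: its
  conclusion shows that the norms still tend to \<open>1\<close>, and applying \<open>T / c\<close> to its conclusion gives the
  approximate eigenvector equation for \<open>TT\<^sup>*\<close>. So \<open>\<parallel>T\<^sup>n x\<^sub>m\<parallel>\<close> tends to \<open>c\<^sup>n\<close>.
\<close>

lemma absolute_paranormal_normaloid:
  fixes T :: "'a::complex_hilbert_space \<Rightarrow>\<^sub>L 'a"
  assumes T: "complex_linear T" and ap: "absolute_paranormal p r T" and p: "p > 0" and r: "r > 0"
    and T0: "T \<noteq> 0"
  shows "norm T ^ n \<le> norm (op_pow T n)"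
proof -
  define c where "c = norm T"
  have c: "c > 0" using T0 by (simp add: c_def)
  obtain x :: "nat \<Rightarrow> 'a" where x: "\<And>m. norm (x m) = 1"
    and x_lim: "(\<lambda>m. blinfun_apply T (blinfun_apply (adj T) (x m)) - c\<^sup>2 *\<^sub>R x m) \<longlonglongrightarrow> 0"
    using norm_adj_attained_approx[OF T T0] by (auto simp: c_def)
  define y where "y = (\<lambda>k m. (1 / c ^ k) *\<^sub>R blinfun_apply (op_pow T k) (x m))"
  have y_Suc: "y (Suc k) m = (1 / c) *\<^sub>R blinfun_apply T (y k m)" for k m
    by (simp add: y_def blinfun.scaleR_right)
  have inv: "(\<lambda>m. norm (y k m)) \<longlonglongrightarrow> 1 \<and>
      (\<lambda>m. blinfun_apply T (blinfun_apply (adj T) (y k m)) - c\<^sup>2 *\<^sub>R y k m) \<longlonglongrightarrow> 0" for k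
  proof (induction k)
    case 0
    then show ?case using x x_lim by (simp add: y_def)
  next
    case (Suc k)
    then have n: "(\<lambda>m. norm (y k m)) \<longlonglongrightarrow> 1" by simp
    have D: "(\<lambda>m. blinfun_apply (adj T) (blinfun_apply T (y k m)) - c\<^sup>2 *\<^sub>R y k m) \<longlonglongrightarrow> 0"
      using absolute_paranormal_approx_eigenvector[OF T ap p r T0] Suc.IH by (simp add: c_def)
    let ?D = "\<lambda>m. blinfun_apply (adj T) (blinfun_apply T (y k m)) - c\<^sup>2 *\<^sub>R y k m"
    have "(\<lambda>m. sqrt ((norm (y k m))\<^sup>2 + re_cinner (?D m) (y k m) / c\<^sup>2)) \<longlonglongrightarrow> sqrt (1\<^sup>2 + 0 / c\<^sup>2)"
    proof (intro tendsto_intros n)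
      show "(\<lambda>m. re_cinner (?D m) (y k m)) \<longlonglongrightarrow> 0"
      proof (rule tendsto_0_le[of "\<lambda>m. norm (?D m) * norm (y k m)" _ _ 1])
        show "(\<lambda>m. norm (?D m) * norm (y k m)) \<longlonglongrightarrow> 0"
          using tendsto_mult[OF tendsto_norm_zero[OF D] n] by simp
        show "\<forall>\<^sub>F m in sequentially. norm (re_cinner (?D m) (y k m)) \<le> norm (norm (?D m) * norm (y k m)) * 1"
          by (simp add: re_cinner_abs_le abs_mult)
      qed
    qed (use c in simp)
    moreover have "sqrt ((norm (y k m))\<^sup>2 + re_cinner (?D m) (y k m) / c\<^sup>2) = norm (y (Suc k) m)" for m
    proof -
      have "(norm (y k m))\<^sup>2 + re_cinner (?D m) (y k m) / c\<^sup>2 = (norm (y (Suc k) m))\<^sup>2"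
        using c by (simp add: y_Suc re_cinner.diff_left re_cinner.scaleR_left re_cinner_self re_cinner_adj_compose[OF T]
            power_divide diff_divide_distrib)
      then show ?thesis by simp
    qed
    ultimately have 1: "(\<lambda>m. norm (y (Suc k) m)) \<longlonglongrightarrow> 1" by simp
    have "(\<lambda>m. (1 / c) *\<^sub>R blinfun_apply T (?D m)) \<longlonglongrightarrow> (1 / c) *\<^sub>R blinfun_apply T 0"
      by (intro tendsto_intros D)
    then have 2: "(\<lambda>m. blinfun_apply T (blinfun_apply (adj T) (y (Suc k) m)) - c\<^sup>2 *\<^sub>R y (Suc k) m) \<longlonglongrightarrow> 0"
      by (simp add: y_Suc blinfun.diff_right blinfun.scaleR_right blinfun.zero_right
          scaleR_diff_right mult.commute)
    show ?case using 1 2 by blast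
  qed
  have "1 \<le> norm (op_pow T n) / c ^ n"
  proof (rule LIMSEQ_le_const2)
    show "(\<lambda>m. norm (y n m)) \<longlonglongrightarrow> 1" using inv by blast
    have "norm (y n m) \<le> norm (op_pow T n) / c ^ n" for m
      using norm_blinfun[of "op_pow T n" "x m"] c by (simp add: y_def x divide_right_mono)
    then show "\<exists>N. \<forall>m\<ge>N. norm (y n m) \<le> norm (op_pow T n) / c ^ n" by blast
  qed
  then show ?thesis using c by (simp add: c_def pos_le_divide_eq)
qed

section \<open>Partial isometries and isometric vectors\<close>

text \<open>Both parts come from \<open>\<parallel>S x\<parallel>\<^sup>2 = \<langle>P x, x\<rangle>\<close> for the projection \<open>P = S\<^sup>*S\<close>; the second says that \<open>S\<close> kills \<open>x - P x\<close>.\<close>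

lemma partial_isometry_norm_le_one_and_regular:
  assumes S: "complex_linear S" and pi: "partial_isometry S"
  shows "norm S \<le> 1"
    and "blinfun_apply S (blinfun_apply (adj S) (blinfun_apply S x)) = blinfun_apply S x"
proof -
  define P where "P = adj S o\<^sub>L S"
  have PP: "blinfun_apply P (blinfun_apply P x) = blinfun_apply P x" for x
    using pi unfolding partial_isometry_def orthogonal_projection_def P_def
    by (metis blinfun_apply_blinfun_compose)
  have nP: "(norm (blinfun_apply S x))\<^sup>2 = re_cinner (blinfun_apply P x) x" for x
    by (simp add: P_def re_cinner_adj_compose[OF S])
  have sP: "selfadj P" unfolding P_def by (intro positive_op_selfadj positive_op_adj_compose S)
  have "norm (blinfun_apply S x) \<le> 1 * norm x" for x
  proof -
    have "(norm (blinfun_apply P x))\<^sup>2 = re_cinner (blinfun_apply P x) x"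
      using selfadj_re_cinner[OF sP, of "blinfun_apply P x" x] by (simp add: PP re_cinner_self)
    then have "(norm (x - blinfun_apply P x))\<^sup>2 = (norm x)\<^sup>2 - re_cinner (blinfun_apply P x) x"
      by (simp add: norm_diff_sq re_cinner_commute[of x])
    then have "(norm (blinfun_apply S x))\<^sup>2 \<le> (norm x)\<^sup>2"
      unfolding nP using zero_le_power2[of "norm (x - blinfun_apply P x)"] by linarith
    then show ?thesis by (simp add: power2_le_iff_abs_le)
  qed
  then show "norm S \<le> 1" by (intro norm_blinfun_bound) auto
  have "(norm (blinfun_apply S (x - blinfun_apply P x)))\<^sup>2 = 0"
    unfolding nP by (simp add: blinfun.diff_right PP re_cinner.zero_left)
  then show "blinfun_apply S (blinfun_apply (adj S) (blinfun_apply S x)) = blinfun_apply S x"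
    by (simp add: P_def blinfun.diff_right)
qed

text \<open>For a contraction, \<open>\<parallel>S\<^sup>*S x - x\<parallel>\<^sup>2 = \<parallel>S\<^sup>*S x\<parallel>\<^sup>2 - 2 \<parallel>S x\<parallel>\<^sup>2 + \<parallel>x\<parallel>\<^sup>2 \<le> \<parallel>x\<parallel>\<^sup>2 - \<parallel>S x\<parallel>\<^sup>2\<close>.\<close>

lemma contraction_isometric_vector:
  assumes S: "complex_linear S" and c: "norm S \<le> 1" and x: "norm x \<le> norm (blinfun_apply S x)"
  shows "blinfun_apply (adj S) (blinfun_apply S x) = x"
proof -
  have "norm (blinfun_apply (adj S) (blinfun_apply S x)) \<le> 1 * norm (blinfun_apply S x)"
    by (rule order_trans[OF norm_adj_apply_le[OF S]]) (intro mult_right_mono c norm_ge_zero)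
  then have "(norm (blinfun_apply (adj S) (blinfun_apply S x)))\<^sup>2 \<le> (norm (blinfun_apply S x))\<^sup>2"
    by (simp add: power_mono)
  moreover have "(norm x)\<^sup>2 \<le> (norm (blinfun_apply S x))\<^sup>2" using x by (simp add: power_mono)
  moreover have "(norm (blinfun_apply (adj S) (blinfun_apply S x) - x))\<^sup>2
      = (norm (blinfun_apply (adj S) (blinfun_apply S x)))\<^sup>2 - 2 * (norm (blinfun_apply S x))\<^sup>2 + (norm x)\<^sup>2"
    by (simp add: norm_diff_sq re_cinner_adj_compose[OF S])
  ultimately have "(norm (blinfun_apply (adj S) (blinfun_apply S x) - x))\<^sup>2 \<le> 0" by linarith
  then show ?thesis by simp
qed

section \<open>Restriction to reducing subspaces\<close>

text \<open>The product \<open>A\<^sup>a Q = (AQ)\<^sup>a\<close> is self-adjoint, which for a product of two self-adjoint operators means that they commute.\<close>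

lemma op_powr_commuting_projection:
  assumes A: "positive_op A" and Q: "selfadj Q" "Q o\<^sub>L Q = Q" and comm: "A o\<^sub>L Q = Q o\<^sub>L A" and a: "a > 0"
  shows "op_powr A a o\<^sub>L Q = Q o\<^sub>L op_powr A a"
proof -
  have "selfadj (op_powr A a o\<^sub>L Q)"
    using positive_op_powr[OF positive_op_compose_commuting_projection[OF A Q comm] a]
    by (simp add: positive_op_selfadj op_powr_compose_commuting_projection[OF A Q comm a])
  then have "op_powr A a o\<^sub>L Q = adj (op_powr A a o\<^sub>L Q)" by (simp add: selfadj_def)
  also have "\<dots> = Q o\<^sub>L op_powr A a"
    using positive_op_selfadj[OF positive_op_powr[OF A a]] Q(1) by (simp add: adj_compose selfadj_def)
  finally show ?thesis .
qed

text \<open>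
  Since \<open>(TQ)\<^sup>*TQ = T\<^sup>*TQ\<close>, the square root is \<open>|TQ| = |T|Q\<close>; and as \<open>|T|\<close> commutes with \<open>Q\<close> in turn, the
  same argument applies to its power.
\<close>

lemma op_powr_abs_compose_projection:
  assumes T: "complex_linear T" and Q: "selfadj Q" "Q o\<^sub>L Q = Q"
    and comm: "T o\<^sub>L Q = Q o\<^sub>L T" "adj T o\<^sub>L Q = Q o\<^sub>L adj T" and a: "a > 0"
  shows "op_powr (op_abs (T o\<^sub>L Q)) a = op_powr (op_abs T) a o\<^sub>L Q"
    and "Q o\<^sub>L op_powr (op_abs T) a = op_powr (op_abs T) a o\<^sub>L Q"
proof -
  define A where "A = adj T o\<^sub>L T"
  have linQ: "complex_linear Q" and adjQ: "adj Q = Q" using Q(1) by (simp_all add: selfadj_def)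
  have comm': "blinfun_apply T (blinfun_apply Q x) = blinfun_apply Q (blinfun_apply T x)"
    "blinfun_apply (adj T) (blinfun_apply Q x) = blinfun_apply Q (blinfun_apply (adj T) x)"
    "blinfun_apply Q (blinfun_apply Q x) = blinfun_apply Q x" for x
    using comm Q(2) by (metis blinfun_apply_blinfun_compose)+
  have posA: "positive_op A" unfolding A_def by (rule positive_op_adj_compose[OF T])
  have AQ: "A o\<^sub>L Q = Q o\<^sub>L A" by (rule blinfun_eqI) (simp add: A_def comm')
  have "adj (T o\<^sub>L Q) o\<^sub>L (T o\<^sub>L Q) = A o\<^sub>L Q"
    by (rule blinfun_eqI) (simp add: adj_compose[OF T linQ] adjQ A_def comm')
  then have abs: "op_abs (T o\<^sub>L Q) = op_abs T o\<^sub>L Q"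
    unfolding op_abs_def
    by (simp add: op_powr_compose_commuting_projection[OF posA Q AQ] flip: A_def)
  have "op_abs T o\<^sub>L Q = Q o\<^sub>L op_abs T"
    unfolding op_abs_def A_def[symmetric] by (rule op_powr_commuting_projection[OF posA Q AQ]) simp
  note c = positive_op_abs[OF T] Q this a
  show "op_powr (op_abs (T o\<^sub>L Q)) a = op_powr (op_abs T) a o\<^sub>L Q"
    unfolding abs by (rule op_powr_compose_commuting_projection[OF c])
  show "Q o\<^sub>L op_powr (op_abs T) a = op_powr (op_abs T) a o\<^sub>L Q"
    by (rule op_powr_commuting_projection[OF c, symmetric])
qed

lemma norm_projection_le:
  assumes Q: "selfadj Q" "Q o\<^sub>L Q = Q"
  shows "norm (blinfun_apply Q x) \<le> norm x"
proof -
  have "partial_isometry Q"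
    using Q by (simp add: partial_isometry_def orthogonal_projection_def selfadj_def)
  then have "norm Q \<le> 1" by (rule partial_isometry_norm_le_one_and_regular(1)[OF selfadj_linear[OF Q(1)]])
  then have "norm Q * norm x \<le> 1 * norm x" by (rule mult_right_mono) simp
  then show ?thesis using norm_blinfun[of Q x] by linarith
qed

text \<open>
  The inequality for \<open>TQ\<close> at \<open>x\<close> is the homogeneous one for \<open>T\<close> at \<open>Q x\<close>, whose additional factor
  \<open>\<parallel>Q x\<parallel>\<^sup>p\<close> is at most \<open>1\<close>.
\<close>

lemma absolute_paranormal_compose_projection:
  fixes T :: "'a::complex_hilbert_space \<Rightarrow>\<^sub>L 'a"
  assumes T: "complex_linear T" and ap: "absolute_paranormal p r T" and p: "p > 0" and r: "r > 0"
    and Q: "selfadj Q" "Q o\<^sub>L Q = Q" and comm: "T o\<^sub>L Q = Q o\<^sub>L T" "adj T o\<^sub>L Q = Q o\<^sub>L adj T"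
  shows "absolute_paranormal p r (T o\<^sub>L Q)"
  unfolding absolute_paranormal_def
proof (intro allI impI)
  fix x :: 'a assume x: "norm x = 1"
  let ?P = "op_powr (op_abs T) p" and ?W = "op_powr (op_abs (adj T)) r"
  let ?y = "blinfun_apply Q x"
  have lin: "complex_linear Q" and adjQ: "adj Q = Q" using Q(1) by (simp_all add: selfadj_def)
  have QQ: "blinfun_apply Q (blinfun_apply Q x) = blinfun_apply Q x" for x
    using Q(2) by (metis blinfun_apply_blinfun_compose)
  have PQ: "op_powr (op_abs (T o\<^sub>L Q)) p = ?P o\<^sub>L Q"
    by (rule op_powr_abs_compose_projection(1)[OF T Q comm p])
  have "adj (T o\<^sub>L Q) = adj T o\<^sub>L Q" by (simp add: adj_compose[OF T lin] adjQ comm(2))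
  moreover have comm2: "adj (adj T) o\<^sub>L Q = Q o\<^sub>L adj (adj T)" using comm(1) T by simp
  note W = op_powr_abs_compose_projection[OF complex_linear_adj[OF T] Q comm(2) comm2 r]
  ultimately have WQ: "op_powr (op_abs (adj (T o\<^sub>L Q))) r = ?W o\<^sub>L Q" by simp
  have QW: "blinfun_apply Q (blinfun_apply ?W ?y) = blinfun_apply ?W ?y"
    using W(2) by (metis QQ blinfun_apply_blinfun_compose)
  have "norm (blinfun_apply ?W ?y) powr (p + r)
      \<le> norm (blinfun_apply ?P (blinfun_apply ?W ?y)) powr r * norm ?y powr p"
    by (rule absolute_paranormal_homogeneous[OF ap p r])
  also have "\<dots> \<le> norm (blinfun_apply ?P (blinfun_apply ?W ?y)) powr r * 1"
    using norm_projection_le[OF Q, of x] x p by (intro mult_left_mono powr_le1) auto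
  finally show "norm (blinfun_apply (op_powr (op_abs (adj (T o\<^sub>L Q))) r) x) powr (p + r)
      \<le> norm (blinfun_apply (op_powr (op_abs (T o\<^sub>L Q)) p o\<^sub>L op_powr (op_abs (adj (T o\<^sub>L Q))) r) x) powr r"
    by (simp add: PQ WQ QW)
qed

section \<open>Partial isometric powers\<close>

text \<open>
  If \<open>T\<^sup>*T x = x\<close>, then \<open>y = T x\<close> satisfies \<open>TT\<^sup>*y = y\<close>; for \<open>x \<noteq> 0\<close> this also forces \<open>\<parallel>T\<parallel> = 1\<close>, so the
  constant sequence \<open>y\<close>, normalised, is an (exact) eigenvector for the largest eigenvalue.
\<close>

lemma isometric_vectors_invariant:
  fixes T :: "'a::complex_hilbert_space \<Rightarrow>\<^sub>L 'a"
  assumes T: "complex_linear T" and ap: "absolute_paranormal p r T" and p: "p > 0" and r: "r > 0"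
    and c: "norm T \<le> 1" and x: "blinfun_apply (adj T) (blinfun_apply T x) = x"
  shows "blinfun_apply (adj T) (blinfun_apply T (blinfun_apply T x)) = blinfun_apply T x"
proof (cases "x = 0")
  case False
  have nx: "norm (blinfun_apply T x) = norm x"
    using re_cinner_adj_compose[OF T, of x] by (simp add: x re_cinner_self)
  have x0: "norm x > 0" using False by simp
  have "norm x \<le> norm T * norm x" using norm_blinfun[of T x] by (simp add: nx)
  then have T1: "norm T = 1" using c x0 by simp
  define y where "y = (1 / norm x) *\<^sub>R blinfun_apply T x"
  have "(\<lambda>_::nat. blinfun_apply (adj T) (blinfun_apply T y) - (norm T)\<^sup>2 *\<^sub>R y) \<longlonglongrightarrow> 0"
  proof (rule absolute_paranormal_approx_eigenvector[OF T ap p r])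
    show "T \<noteq> 0" using T1 by auto
    show "(\<lambda>_. norm y) \<longlonglongrightarrow> 1" using x0 by (simp add: y_def nx)
    show "(\<lambda>_. blinfun_apply T (blinfun_apply (adj T) y) - (norm T)\<^sup>2 *\<^sub>R y) \<longlonglongrightarrow> 0"
      by (simp add: y_def blinfun.scaleR_right x T1)
  qed
  then show ?thesis using x0 by (simp add: LIMSEQ_const_iff T1 y_def blinfun.scaleR_right)
qed (simp add: blinfun.zero_right)

lemma norm_op_pow_apply_le:
  assumes "norm T \<le> 1" shows "norm (blinfun_apply (op_pow T k) x) \<le> norm x"
proof (induction k)
  case (Suc k)
  have "norm (blinfun_apply T (blinfun_apply (op_pow T k) x)) \<le> 1 * norm (blinfun_apply (op_pow T k) x)"
    by (rule order_trans[OF norm_blinfun]) (intro mult_right_mono assms norm_ge_zero)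
  with Suc show ?case by simp
qed simp

text \<open>
  \<open>P\<close> projects onto the isometric vectors of \<open>T\<close> and along \<open>ker T\<^sup>n\<close>; both are invariant under \<open>T\<close>, so
  \<open>T\<close> splits into an isometry and the nilpotent operator \<open>N\<close>, which must be zero.
\<close>

lemma partial_isometry_power_imp_quasinormal_partial_isometry:
  fixes T :: "'a::complex_hilbert_space \<Rightarrow>\<^sub>L 'a"
  assumes T: "complex_linear T" and ap: "absolute_paranormal p r T" and p: "p > 0" and r: "r > 0"
    and n: "n > 0" and pi: "partial_isometry (op_pow T n)"
  shows "quasinormal T \<and> partial_isometry T"
proof -
  define S where "S = op_pow T n"
  define P where "P = adj S o\<^sub>L S"
  have S: "complex_linear S" using T by (simp add: S_def)
  have S1: "norm S \<le> 1" and SP: "blinfun_apply S (blinfun_apply P x) = blinfun_apply S x" for x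
    using partial_isometry_norm_le_one_and_regular[OF S] pi by (simp_all add: S_def P_def)
  have P: "selfadj P" unfolding P_def by (intro positive_op_selfadj positive_op_adj_compose S)
  have PP': "P o\<^sub>L P = P"
    using pi by (simp add: partial_isometry_def orthogonal_projection_def S_def P_def)
  then have PP: "blinfun_apply P (blinfun_apply P x) = blinfun_apply P x" for x
    by (metis blinfun_apply_blinfun_compose)
  have T1: "norm T \<le> 1"
  proof (cases "T = 0")
    case False
    have "norm T ^ n \<le> 1"
      using absolute_paranormal_normaloid[OF T ap p r False, of n] S1 by (simp add: S_def)
    then show ?thesis using n one_less_power[of "norm T" n] by linarith
  qed simp
  \<comment> \<open>\<open>T\<close> is isometric along the whole orbit of \<open>x\<close>, so \<open>T\<^sup>n\<close> preserves its norm\<close>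
  have isom_P: "blinfun_apply P x = x"
    if x: "blinfun_apply (adj T) (blinfun_apply T x) = x" for x
  proof -
    have "blinfun_apply (adj T) (blinfun_apply T (blinfun_apply (op_pow T k) x)) = blinfun_apply (op_pow T k) x
        \<and> norm (blinfun_apply (op_pow T k) x) = norm x" for k
    proof (induction k)
      case (Suc k)
      let ?z = "blinfun_apply (op_pow T k) x"
      have z: "blinfun_apply (adj T) (blinfun_apply T ?z) = ?z" using Suc by simp
      then have "norm (blinfun_apply T ?z) = norm ?z"
        using re_cinner_adj_compose[OF T, of ?z] by (simp add: re_cinner_self)
      then show ?case using Suc isometric_vectors_invariant[OF T ap p r T1 z] by simp
    qed (simp add: x)
    then have "norm x \<le> norm (blinfun_apply S x)" by (simp add: S_def)
    then show ?thesis using contraction_isometric_vector[OF S S1] by (simp add: P_def)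
  qed
  \<comment> \<open>\<open>T\<^sup>n\<close> preserves the norm on the range of \<open>P\<close>; being contractive, so does its first factor \<open>T\<close>\<close>
  have P_isom: "blinfun_apply (adj T) (blinfun_apply T (blinfun_apply P x)) = blinfun_apply P x" for x
  proof (rule contraction_isometric_vector[OF T T1])
    let ?z = "blinfun_apply P x"
    obtain k where k: "n = Suc k" using n gr0_implies_Suc by blast
    have "(norm ?z)\<^sup>2 = (norm (blinfun_apply S ?z))\<^sup>2"
      using re_cinner_adj_compose[OF S, of ?z] PP[of x] by (simp add: P_def re_cinner_self)
    then have "norm ?z = norm (blinfun_apply S ?z)" by simp
    also have "\<dots> = norm (blinfun_apply (op_pow T k) (blinfun_apply T ?z))"
      by (simp add: S_def k op_pow_commute)
    also have "\<dots> \<le> norm (blinfun_apply T ?z)" by (rule norm_op_pow_apply_le[OF T1])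
    finally show "norm ?z \<le> norm (blinfun_apply T ?z)" .
  qed
  have PT: "blinfun_apply P (blinfun_apply T x) = blinfun_apply T (blinfun_apply P x)" for x
  proof -
    have "blinfun_apply P (blinfun_apply T (blinfun_apply P x)) = blinfun_apply T (blinfun_apply P x)"
      by (intro isom_P isometric_vectors_invariant[OF T ap p r T1] P_isom)
    moreover have "blinfun_apply S (blinfun_apply T (x - blinfun_apply P x)) = 0"
      by (simp add: S_def op_pow_commute blinfun.diff_right SP[unfolded S_def])
    then have "blinfun_apply P (blinfun_apply T (x - blinfun_apply P x)) = 0"
      by (simp add: P_def blinfun.zero_right)
    ultimately show ?thesis by (simp add: blinfun.diff_right)
  qed
  define Q where "Q = id_blinfun - P"
  have Q_apply: "blinfun_apply Q x = x - blinfun_apply P x" for x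
    by (simp add: Q_def blinfun.diff_left)
  have Q: "selfadj Q"
    using selfadj_add[OF selfadj_id selfadj_scaleR[OF P, of "-1"]] by (simp add: Q_def)
  have QQ: "Q o\<^sub>L Q = Q" by (rule blinfun_eqI) (simp add: Q_apply blinfun.diff_right PP)
  have TQ: "T o\<^sub>L Q = Q o\<^sub>L T" by (rule blinfun_eqI) (simp add: Q_apply blinfun.diff_right PT)
  then have "adj (Q o\<^sub>L T) = adj (T o\<^sub>L Q)" by simp
  then have TQ': "adj T o\<^sub>L Q = Q o\<^sub>L adj T"
    using Q T by (simp add: adj_compose selfadj_def)
  define N where "N = T o\<^sub>L Q"
  have N: "complex_linear N" using T Q by (simp add: N_def selfadj_linear)
  have apN: "absolute_paranormal p r N"
    unfolding N_def by (rule absolute_paranormal_compose_projection[OF T ap p r Q QQ TQ TQ'])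
  have N_pow: "blinfun_apply (op_pow N (Suc k)) x = blinfun_apply (op_pow T (Suc k)) (blinfun_apply Q x)" for k x
  proof (induction k)
    case (Suc k)
    let ?w = "blinfun_apply (op_pow T (Suc k)) (blinfun_apply Q x)"
    have "blinfun_apply P (blinfun_apply (op_pow T j) y) = blinfun_apply (op_pow T j) (blinfun_apply P y)" for j y
      by (induction j) (simp_all add: PT)
    then have "blinfun_apply Q ?w = ?w"
      by (simp add: Q_apply blinfun.diff_right PP PT)
    moreover have "blinfun_apply (op_pow N (Suc (Suc k))) x = blinfun_apply N (blinfun_apply (op_pow N (Suc k)) x)"
      by simp
    ultimately show ?case unfolding Suc.IH by (simp add: N_def)
  qed (simp add: N_def)
  obtain k where k: "n = Suc k" using n gr0_implies_Suc by blast
  have "op_pow N n = 0"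
  proof (rule blinfun_eqI)
    fix x
    have "blinfun_apply (op_pow N n) x = blinfun_apply S (blinfun_apply Q x)"
      unfolding S_def k by (rule N_pow)
    then show "blinfun_apply (op_pow N n) x = blinfun_apply 0 x"
      by (simp add: Q_apply blinfun.diff_right SP)
  qed
  have "N = 0"
  proof (rule ccontr)
    assume N0: "N \<noteq> 0"
    then have "0 < norm N ^ n" by simp
    also have "\<dots> \<le> norm (op_pow N n)" by (rule absolute_paranormal_normaloid[OF N apN p r N0])
    finally show False using \<open>op_pow N n = 0\<close> by simp
  qed
  have TP: "blinfun_apply T (blinfun_apply P x) = blinfun_apply T x" for x
  proof -
    have "blinfun_apply N x = 0" by (simp add: \<open>N = 0\<close>)
    then show ?thesis by (simp add: N_def Q_apply blinfun.diff_right)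
  qed
  have TT: "adj T o\<^sub>L T = P"
    by (rule blinfun_eqI) (metis P_isom TP blinfun_apply_blinfun_compose)
  have "quasinormal T"
    unfolding quasinormal_def TT by (rule blinfun_eqI) (simp add: PT)
  moreover have "partial_isometry T"
    unfolding partial_isometry_def TT orthogonal_projection_def
    using PP' P by (simp add: selfadj_def)
  ultimately show ?thesis ..
qed

section \<open>Quasinormal partial isometries are absolute-paranormal\<close>

text \<open>\<open>E = 1 \<cdot> E\<close>, and \<open>1\<^sup>a = 1\<close> because every vector is an eigenvector of the identity.\<close>

lemma op_powr_projection:
  fixes E :: "'a::complex_hilbert_space \<Rightarrow>\<^sub>L 'a"
  assumes E: "selfadj E" "E o\<^sub>L E = E" and a: "a > 0"
  shows "op_powr E a = E"
proof -
  have id: "positive_op (id_blinfun :: 'a \<Rightarrow>\<^sub>L 'a)"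
    by (simp add: positive_op_def selfadj_id re_cinner_self)
  have "op_powr (id_blinfun :: 'a \<Rightarrow>\<^sub>L 'a) a = id_blinfun"
    by (rule blinfun_eqI) (use op_powr_eigenvector[OF id a, of 1] in simp)
  moreover have "(id_blinfun :: 'a \<Rightarrow>\<^sub>L 'a) o\<^sub>L E = E" "E o\<^sub>L (id_blinfun :: 'a \<Rightarrow>\<^sub>L 'a) = E"
    by (auto intro: blinfun_eqI)
  ultimately show ?thesis
    using op_powr_compose_commuting_projection[OF id E _ a] by simp
qed

text \<open>
  Here \<open>|T|\<close> and \<open>|T\<^sup>*|\<close> are the projections \<open>A\<close> and \<open>E\<close>, and \<open>A\<close> fixes the range of \<open>E\<close>; what remains is
  \<open>\<parallel>E x\<parallel>\<^sup>2 \<le> \<parallel>E x\<parallel>\<close> for a unit vector \<open>x\<close>.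
\<close>

lemma quasinormal_partial_isometry_imp_absolute_paranormal:
  fixes T :: "'a::complex_hilbert_space \<Rightarrow>\<^sub>L 'a"
  assumes T: "complex_linear T" and qn: "quasinormal T" and pi: "partial_isometry T"
  shows "absolute_paranormal 1 1 T"
proof -
  define A where "A = adj T o\<^sub>L T"
  define E where "E = T o\<^sub>L adj T"
  have TA: "blinfun_apply T (blinfun_apply A x) = blinfun_apply T x" for x
    using partial_isometry_norm_le_one_and_regular(2)[OF T pi] by (simp add: A_def)
  have AT: "blinfun_apply A (blinfun_apply T x) = blinfun_apply T x" for x
    using qn TA unfolding quasinormal_def A_def[symmetric] by (metis blinfun_apply_blinfun_compose)
  have A: "selfadj A" "A o\<^sub>L A = A"
    using pi T positive_op_selfadj[OF positive_op_adj_compose[OF T]]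
    by (simp_all add: A_def partial_isometry_def orthogonal_projection_def)
  have E: "selfadj E" "E o\<^sub>L E = E"
    using positive_op_selfadj[OF positive_op_adj_compose[of "adj T"]] T
    by (simp_all add: E_def) (rule blinfun_eqI, use TA in \<open>simp add: A_def\<close>)
  have abs: "op_abs T = A" "op_abs (adj T) = E"
    unfolding op_abs_def using T by (simp_all add: op_powr_projection A E flip: A_def E_def)
  have le: "norm (blinfun_apply E x) \<le> norm x" for x by (rule norm_projection_le[OF E])
  have AE: "blinfun_apply A (blinfun_apply E x) = blinfun_apply E x" for x by (simp add: E_def AT)
  have "norm (blinfun_apply E x) powr 2 \<le> norm (blinfun_apply E x) powr 1" if "norm x = 1" for x
    using le[of x] that by (intro powr_mono') auto
  then show ?thesis
    by (simp add: absolute_paranormal_def abs op_powr_projection A E AE)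
qed

theorem theorem5p3:
  fixes T :: "'a::complex_hilbert_space \<Rightarrow>\<^sub>L 'a"
  assumes "complex_linear T"
  shows "(quasinormal T \<and> partial_isometry T) \<longleftrightarrow>
    ((\<exists>p r :: real. p > 0 \<and> r > 0 \<and> absolute_paranormal p r T) \<and>
     (\<exists>n :: nat. n > 0 \<and> partial_isometry (op_pow T n)))"
proof
  assume i: "quasinormal T \<and> partial_isometry T"
  then have "absolute_paranormal 1 1 T"
    using quasinormal_partial_isometry_imp_absolute_paranormal[OF assms] by blast
  moreover have "op_pow T 1 = T" by (rule blinfun_eqI) simp
  ultimately show "(\<exists>p r :: real. p > 0 \<and> r > 0 \<and> absolute_paranormal p r T) \<and>
     (\<exists>n :: nat. n > 0 \<and> partial_isometry (op_pow T n))"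
    using i by (metis zero_less_one)
next
  assume "(\<exists>p r :: real. p > 0 \<and> r > 0 \<and> absolute_paranormal p r T) \<and>
     (\<exists>n :: nat. n > 0 \<and> partial_isometry (op_pow T n))"
  then show "quasinormal T \<and> partial_isometry T"
    using partial_isometry_power_imp_quasinormal_partial_isometry[OF assms] by blast
qed

end
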